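(* Let $\mathbf{u}_0\in C^\omega(\mathbb{T}^3)$ be a real-analytic $\mathbb{R}^3$-valued vector field. Then there exists a time $T>0$ such that the Cauchy problem $$\partial_t\mathbf{u}+(\nabla\times\mathbf{u})\times\mathbf{u}=\mathbf{0},\qquad \mathbf{u}(0)=\mathbf{u}_0,$$ on $\mathbb{T}^3$ has a unique solution $\mathbf{u}\in C^\omega([-T,T]\times\mathbb{T}^3)$.
   Context: $\mathbb{T}^3=\mathbb{R}^3/(2\pi\mathbb{Z})^3$; $C^\omega$ denotes real-analytic ($\mathbb{R}^3$-valued) functions. The field $\mathbf{u}$ is not required to be divergence-free. *)

theory Defs
  imports "HOL-Analysis.Analysis"
begin

section \<open>Real-analytic functions of several variables\<close>

text \<open>
  Near \<open>x\<close> the function is the sum of a power series in the coordinates of \<open>y - x\<close>. The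
  multi-indices are the functions \<open>Basis \<Rightarrow> nat\<close> (fixed to be \<open>undefined\<close> outside \<open>Basis\<close>), and the
  multiple series converges unconditionally.
\<close>

definition real_analytic_at ::
    "('a::euclidean_space \<Rightarrow> 'b::real_normed_vector) \<Rightarrow> 'a \<Rightarrow> bool" where
  "real_analytic_at f x \<longleftrightarrow>
     (\<exists>r>0. \<exists>c :: ('a \<Rightarrow> nat) \<Rightarrow> 'b. \<forall>y\<in>ball x r.
        ((\<lambda>\<alpha>. (\<Prod>b\<in>Basis. ((y - x) \<bullet> b) ^ \<alpha> b) *\<^sub>R c \<alpha>) has_sum f y) (Basis \<rightarrow>\<^sub>E UNIV))"

text \<open>
  On a set that need not be open, such as \<open>[-T, T] \<times> \<real>\<^sup>3\<close>, analyticity means, as usual, that the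
  restriction to the set extends to a real-analytic function on an open neighbourhood of it. The
  values of \<open>f\<close> outside \<open>S\<close> play no role.
\<close>

definition real_analytic_on ::
    "('a::euclidean_space \<Rightarrow> 'b::real_normed_vector) \<Rightarrow> 'a set \<Rightarrow> bool" where
  "real_analytic_on f S \<longleftrightarrow>
     (\<exists>U g. open U \<and> S \<subseteq> U \<and> (\<forall>x\<in>U. real_analytic_at g x) \<and> (\<forall>x\<in>S. g x = f x))"


section \<open>Fields on the torus\<close>

text \<open>
  Functions on \<open>\<real>\<^sup>3 / (2\<pi>\<int>)\<^sup>3\<close> are represented by their lifts to \<open>\<real>\<^sup>3\<close>. As the projection is a local
  analytic diffeomorphism, analyticity and derivatives are those of the lift.
\<close>

definition torus_periodic :: "(real^3 \<Rightarrow> 'b) \<Rightarrow> bool" where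
  "torus_periodic f \<longleftrightarrow> (\<forall>x i. f (x + (2 * pi) *\<^sub>R axis i 1) = f x)"

definition curl :: "(real^3 \<Rightarrow> real^3) \<Rightarrow> real^3 \<Rightarrow> real^3" where
  "curl v x = (let J = jacobian v (at x) in
     vector [J $ 3 $ 2 - J $ 2 $ 3, J $ 1 $ 3 - J $ 3 $ 1, J $ 2 $ 1 - J $ 1 $ 2])"


section \<open>The Cauchy problem\<close>

text \<open>
  A solution \<open>u\<close> on \<open>[-T, T] \<times> \<real>\<^sup>3 / (2\<pi>\<int>)\<^sup>3\<close> of class \<open>C\<^sup>\<omega>\<close>. The time derivative is one-sided at
  \<open>t = \<plusminus>T\<close>; all derivatives exist because of the analyticity requirement.
\<close>

definition analytic_solution ::
    "(real^3 \<Rightarrow> real^3) \<Rightarrow> real \<Rightarrow> (real \<Rightarrow> real^3 \<Rightarrow> real^3) \<Rightarrow> bool" where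
  "analytic_solution u0 T u \<longleftrightarrow>
     (\<forall>t\<in>{-T..T}. torus_periodic (u t)) \<and>
     real_analytic_on (\<lambda>(t, x). u t x) ({-T..T} \<times> UNIV) \<and>
     (\<forall>t\<in>{-T..T}. \<forall>x.
        vector_derivative (\<lambda>s. u s x) (at t within {-T..T}) + cross3 (curl (u t) x) (u t x) = 0) \<and>
     (\<forall>x. u 0 x = u0 x)"

end

theory Submission
  imports Defs "HOL-Complex_Analysis.Cauchy_Integral_Formula"
begin

text \<open>
  The solution is the power series \<open>u t x = \<Sum>n. t ^ n *\<^sub>R a n x\<close> whose coefficients are forced by the equation:
  \<open>a 0 = u0\<close> and \<open>(n + 1) a (n + 1) = - (\<Sum>k\<le>n. (curl (a k)) \<times> a (n - k))\<close>. In the norms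
  \<open>\<Sum>\<alpha>. norm (c \<alpha>) * s ^ \<bar>\<alpha>\<bar>\<close> on Taylor coefficients, products are bounded by products and a derivative costs
  a factor \<open>1 / (s' - s)\<close>, so that \<open>a n\<close> has norm at most \<open>m n / (s0 - s) ^ n\<close> with \<open>m\<close> of geometric growth
  (a Catalan-type recursion). By periodicity and compactness \<open>s0\<close> does not depend on the base point, hence
  neither does the radius of convergence in time. Conversely, the time coefficients at \<open>0\<close> of an analytic
  solution satisfy the same recursion near every point, so that it agrees with \<open>u\<close> for small times, and
  for fixed \<open>x\<close> the identity theorem in \<open>t\<close> extends the agreement to \<open>[-T, T]\<close>.
\<close>

section \<open>Power series in several variables\<close>

text \<open>At the level of coefficients the loss becomes a factor of order \<open>k + 1\<close> for
  the curl of the \<open>k\<close>-th coefficient, while the recursion divides by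
  \<open>n + 1\<close> with \<open>k \<le> n\<close>; the two cancel, and only a quadratic recursion
  for the norms is left. Existence and uniqueness meet in \<open>residual\<close>, the time
  coefficients of the left-hand side of the equation. For the constructed series they vanish by
  definition; for a given solution they vanish because a power series with sum zero has zero
  coefficients. The second argument is local: the radius comes with the base point. Agreement is
  therefore first obtained for a time that may depend on \<open>x\<close>, which is harmless because
  the continuation in \<open>t\<close> keeps \<open>x\<close> fixed.\<close>

lemma has_sum_fibers:
  fixes f :: "'i \<Rightarrow> 'b::{topological_comm_monoid_add,t3_space}"
  assumes f: "(f has_sum S) I" and p: "p ` I \<subseteq> J"
    and g: "\<And>j. j \<in> J \<Longrightarrow> (f has_sum g j) {i\<in>I. p i = j}"
  shows "(g has_sum S) J"
proof -
  have "((\<lambda>(j, i). f i) has_sum S) (SIGMA j:J. {i\<in>I. p i = j})"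
    using f p by (subst has_sum_reindex_bij_witness[where i="\<lambda>i. (p i, i)" and j=snd and T=I and h=f and s'=S]) auto
  then show ?thesis
    by (rule has_sum_SigmaD) (use g in auto)
qed

text \<open>In a Banach space every subfamily of a summable family is summable, so the fibre sums
  exist by themselves. Grouping of this kind collects equal monomials and slices a series by powers
  of time.\<close>

lemma has_sum_fibers_infsum:
  fixes f :: "'i \<Rightarrow> 'b::banach"
  assumes f: "(f has_sum S) I" and p: "p ` I \<subseteq> J"
  shows "((\<lambda>j. \<Sum>\<^sub>\<infinity>i\<in>{i\<in>I. p i = j}. f i) has_sum S) J"
proof (rule has_sum_fibers[OF f p])
  fix j
  have "f summable_on {i\<in>I. p i = j}"
    using has_sum_imp_summable[OF f] by (rule summable_on_subset_banach) auto
  then show "(f has_sum (\<Sum>\<^sub>\<infinity>i\<in>{i\<in>I. p i = j}. f i)) {i\<in>I. p i = j}"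
    by (rule has_sum_infsum)
qed

lemma has_sum_product_nonneg:
  fixes u v :: "_ \<Rightarrow> real"
  assumes u: "(u has_sum U) I" and v: "(v has_sum V) J"
    and "\<And>i. i \<in> I \<Longrightarrow> 0 \<le> u i" "\<And>j. j \<in> J \<Longrightarrow> 0 \<le> v j"
  shows "((\<lambda>(i, j). u i * v j) has_sum U * V) (I \<times> J)"
proof (rule has_sum_SigmaI)
  show inner: "((\<lambda>j. case (i, j) of (i, j) \<Rightarrow> u i * v j) has_sum u i * V) J" for i
    using has_sum_cmult_right[OF v, of "u i"] by simp
  show outer: "((\<lambda>i. u i * V) has_sum U * V) I"
    using has_sum_cmult_left[OF u, of V] by simp
  show "(\<lambda>(i, j). u i * v j) summable_on I \<times> J"
    by (rule summable_on_SigmaI[OF inner has_sum_imp_summable[OF outer]]) (use assms in auto)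
qed

lemma summable_on_bilinear:
  fixes B :: "'a::real_normed_vector \<Rightarrow> 'b::real_normed_vector \<Rightarrow> 'c::banach"
  assumes "bounded_bilinear B"
    and f: "(\<lambda>i. norm (f i)) summable_on I" and g: "(\<lambda>j. norm (g j)) summable_on J"
  shows "(\<lambda>z. norm (case z of (i, j) \<Rightarrow> B (f i) (g j))) summable_on I \<times> J"
proof -
  interpret bounded_bilinear B by fact
  obtain K where K: "\<And>a b. norm (B a b) \<le> norm a * norm b * K"
    using bounded by blast
  have "(\<lambda>(i, j). norm (f i) * norm (g j)) summable_on I \<times> J"
    using has_sum_product_nonneg[OF has_sum_infsum[OF f] has_sum_infsum[OF g]]
    by (auto intro: has_sum_imp_summable)
  then have "(\<lambda>z. K * (case z of (i, j) \<Rightarrow> norm (f i) * norm (g j))) summable_on I \<times> J"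
    by (rule summable_on_cmult_right)
  then show ?thesis
    by (rule Infinite_Sum.abs_summable_on_comparison_test') (use K in \<open>auto simp: mult_ac\<close>)
qed

lemma has_sum_bilinear:
  fixes B :: "'a::real_normed_vector \<Rightarrow> 'b::real_normed_vector \<Rightarrow> 'c::banach"
  assumes B: "bounded_bilinear B"
    and f: "(\<lambda>i. norm (f i)) summable_on I" and g: "(\<lambda>j. norm (g j)) summable_on J"
    and F: "(f has_sum F) I" and G: "(g has_sum G) J"
  shows "((\<lambda>(i, j). B (f i) (g j)) has_sum B F G) (I \<times> J)"
proof (rule has_sum_SigmaI)
  interpret bounded_bilinear B by fact
  show "((\<lambda>j. case (i, j) of (i, j) \<Rightarrow> B (f i) (g j)) has_sum B (f i) G) J" for i
    using has_sum_bounded_linear[OF bounded_linear_right G, of "f i"] by (simp add: o_def)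
  show "((\<lambda>i. B (f i) G) has_sum B F G) I"
    using has_sum_bounded_linear[OF bounded_linear_left F, of G] by (simp add: o_def)
  show "(\<lambda>(i, j). B (f i) (g j)) summable_on I \<times> J"
    by (rule abs_summable_summable[OF summable_on_bilinear[OF B f g]])
qed

section \<open>Multi-indices, monomials and weighted norms\<close>

definition mdeg :: "('a::euclidean_space \<Rightarrow> nat) \<Rightarrow> nat" where
  "mdeg \<alpha> = (\<Sum>b\<in>Basis. \<alpha> b)"

definition mpow :: "'a::euclidean_space \<Rightarrow> ('a \<Rightarrow> nat) \<Rightarrow> real" where
  "mpow h \<alpha> = (\<Prod>b\<in>Basis. (h \<bullet> b) ^ \<alpha> b)"

abbreviation multi_indices :: "('a::euclidean_space \<Rightarrow> nat) set" where
  "multi_indices \<equiv> Basis \<rightarrow>\<^sub>E UNIV"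

text \<open>Closed balls of the maximum norm rather than Euclidean ones: the bound
  \<open>s ^ mdeg \<alpha>\<close> for monomials is attained at the corner, radii add under
  recentering, and a cube in space-time is an interval times a cube in space.\<close>

definition cube :: "real \<Rightarrow> 'a::euclidean_space set" where
  "cube s = {h. \<forall>b\<in>Basis. \<bar>h \<bullet> b\<bar> \<le> s}"

lemma cubeD: "h \<in> cube s \<Longrightarrow> b \<in> Basis \<Longrightarrow> \<bar>h \<bullet> b\<bar> \<le> s"
  by (auto simp: cube_def)

lemma zero_in_cube [simp]: "0 \<le> s \<Longrightarrow> 0 \<in> cube s"
  by (auto simp: cube_def)

lemma cube_mono: "s \<le> t \<Longrightarrow> cube s \<subseteq> cube t"
  by (force simp: cube_def)

lemma ball_subset_cube: "h \<in> ball 0 s \<Longrightarrow> h \<in> cube s"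
  by (auto simp: cube_def intro: order_trans[OF Basis_le_norm])

lemma abs_mpow_le:
  assumes "h \<in> cube s"
  shows "\<bar>mpow h \<alpha>\<bar> \<le> s ^ mdeg \<alpha>"
proof -
  have "\<bar>mpow h \<alpha>\<bar> = (\<Prod>b\<in>Basis. \<bar>h \<bullet> b\<bar> ^ \<alpha> b)"
    by (simp add: mpow_def abs_prod power_abs)
  also have "\<dots> \<le> (\<Prod>b\<in>Basis. s ^ \<alpha> b)"
    by (intro prod_mono) (auto intro!: power_mono cubeD[OF assms])
  also have "\<dots> = s ^ mdeg \<alpha>"
    by (simp add: mdeg_def power_sum)
  finally show ?thesis .
qed

text \<open>
  \<open>N\<close> bounds the weighted \<open>\<ell>\<^sup>1\<close> norm of the coefficients, the norm of the scale of Banach algebras in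
  which the Cauchy--Kovalevskaya estimate is carried out.
\<close>

definition has_mps ::
    "('a::euclidean_space \<Rightarrow> 'b::real_normed_vector) \<Rightarrow> 'a \<Rightarrow> real \<Rightarrow> real \<Rightarrow> bool" where
  "has_mps f x s N \<longleftrightarrow> 0 < s \<and>
     (\<exists>c. (\<lambda>\<alpha>. norm (c \<alpha>) * s ^ mdeg \<alpha>) summable_on multi_indices \<and>
          (\<Sum>\<^sub>\<infinity>\<alpha>\<in>multi_indices. norm (c \<alpha>) * s ^ mdeg \<alpha>) \<le> N \<and>
          (\<forall>h\<in>cube s. ((\<lambda>\<alpha>. mpow h \<alpha> *\<^sub>R c \<alpha>) has_sum f (x + h)) multi_indices))"

lemma has_mpsE:
  assumes "has_mps f x s N"
  obtains c where "0 < s" "(\<lambda>\<alpha>. norm (c \<alpha>) * s ^ mdeg \<alpha>) summable_on multi_indices"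
    "(\<Sum>\<^sub>\<infinity>\<alpha>\<in>multi_indices. norm (c \<alpha>) * s ^ mdeg \<alpha>) \<le> N"
    "\<And>h. h \<in> cube s \<Longrightarrow> ((\<lambda>\<alpha>. mpow h \<alpha> *\<^sub>R c \<alpha>) has_sum f (x + h)) multi_indices"
  using assms unfolding has_mps_def by blast

lemma has_mps_pos: "has_mps f x s N \<Longrightarrow> 0 < s"
  by (simp add: has_mps_def)

lemma has_mps_cong:
  assumes "has_mps f x s N" "\<And>h. h \<in> cube s \<Longrightarrow> f (x + h) = g (y + h)"
  shows "has_mps g y s N"
  using assms unfolding has_mps_def by simp

lemma summable_on_mpow_scaleR:
  assumes "(\<lambda>i. norm (c i) * s ^ mdeg (\<alpha> i)) summable_on I" "h \<in> cube s"
  shows "(\<lambda>i. norm (mpow h (\<alpha> i) *\<^sub>R c i)) summable_on I"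
  using assms(1)
  by (rule Infinite_Sum.abs_summable_on_comparison_test')
     (use abs_mpow_le[OF assms(2)] in \<open>auto simp: mult.commute[of "norm _"] intro: mult_right_mono\<close>)

text \<open>
  Several indices \<open>i\<close> may carry the same monomial. Products, recentered series and derivatives are then
  again series of this kind, and no coefficients have to be collected by hand.
\<close>

lemma has_mps_collect:
  fixes c :: "'i \<Rightarrow> 'b::banach" and f :: "'a::euclidean_space \<Rightarrow> 'b"
  assumes s: "0 < s" and \<alpha>: "\<alpha> ` I \<subseteq> multi_indices"
    and w: "((\<lambda>i. norm (c i) * s ^ mdeg (\<alpha> i)) has_sum W) I" and W: "W \<le> N"
    and f: "\<And>h. h \<in> cube s \<Longrightarrow> ((\<lambda>i. mpow h (\<alpha> i) *\<^sub>R c i) has_sum f (x + h)) I"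
  shows "has_mps f x s N"
proof -
  define d where "d \<gamma> = (\<Sum>\<^sub>\<infinity>i\<in>{i\<in>I. \<alpha> i = \<gamma>}. c i)" for \<gamma>
  define v where "v \<gamma> = (\<Sum>\<^sub>\<infinity>i\<in>{i\<in>I. \<alpha> i = \<gamma>}. norm (c i) * s ^ mdeg (\<alpha> i))" for \<gamma>
  have v: "(v has_sum W) multi_indices"
    unfolding v_def by (rule has_sum_fibers_infsum[OF w \<alpha>])
  \<comment> \<open>On a fibre the weight is the positive constant \<open>s ^ mdeg \<gamma>\<close>,
    which can be divided off.\<close>
  have fibre: "(\<lambda>i. norm (c i)) summable_on {i\<in>I. \<alpha> i = \<gamma>}" for \<gamma>
  proof -
    have "(\<lambda>i. norm (c i) * s ^ mdeg (\<alpha> i)) summable_on {i\<in>I. \<alpha> i = \<gamma>}"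
      using has_sum_imp_summable[OF w] by (rule summable_on_subset_banach) auto
    then have "(\<lambda>i. norm (c i) * s ^ mdeg \<gamma>) summable_on {i\<in>I. \<alpha> i = \<gamma>}"
      by (subst (asm) summable_on_cong) auto
    then show ?thesis
      using s by (auto dest: summable_on_cmult_left[where c="inverse (s ^ mdeg \<gamma>)"] simp: mult.assoc)
  qed
  have le: "norm (d \<gamma>) * s ^ mdeg \<gamma> \<le> v \<gamma>" for \<gamma>
  proof -
    have "norm (d \<gamma>) \<le> (\<Sum>\<^sub>\<infinity>i\<in>{i\<in>I. \<alpha> i = \<gamma>}. norm (c i))"
      unfolding d_def by (rule norm_infsum_bound[OF fibre])
    moreover have "v \<gamma> = (\<Sum>\<^sub>\<infinity>i\<in>{i\<in>I. \<alpha> i = \<gamma>}. norm (c i)) * s ^ mdeg \<gamma>"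
      unfolding v_def by (subst infsum_cmult_left'[symmetric]) (rule infsum_cong, auto)
    ultimately show ?thesis
      using s by simp
  qed
  have sd: "(\<lambda>\<gamma>. norm (d \<gamma>) * s ^ mdeg \<gamma>) summable_on multi_indices"
    by (rule summable_on_comparison_test[OF has_sum_imp_summable[OF v]]) (use le s in auto)
  have "(\<Sum>\<^sub>\<infinity>\<gamma>\<in>multi_indices. norm (d \<gamma>) * s ^ mdeg \<gamma>) \<le> W"
    using has_sum_mono[OF has_sum_infsum[OF sd] v] le by auto
  moreover have "((\<lambda>\<gamma>. mpow h \<gamma> *\<^sub>R d \<gamma>) has_sum f (x + h)) multi_indices" if h: "h \<in> cube s" for h
  proof (rule has_sum_fibers[OF f[OF h] \<alpha>])
    fix \<gamma>
    have "((\<lambda>i. mpow h \<gamma> *\<^sub>R c i) has_sum mpow h \<gamma> *\<^sub>R d \<gamma>) {i\<in>I. \<alpha> i = \<gamma>}"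
      unfolding d_def by (rule has_sum_scaleR[OF has_sum_infsum[OF abs_summable_summable[OF fibre]]])
    then show "((\<lambda>i. mpow h (\<alpha> i) *\<^sub>R c i) has_sum mpow h \<gamma> *\<^sub>R d \<gamma>) {i\<in>I. \<alpha> i = \<gamma>}"
      by (subst has_sum_cong[where g="\<lambda>i. mpow h \<gamma> *\<^sub>R c i"]) auto
  qed
  ultimately show ?thesis
    unfolding has_mps_def using s sd W by (intro conjI exI[of _ d]) auto
qed

text \<open>A majorant \<open>w\<close> with known sum replaces the exact weights; most operations
  on series are estimated in this form.\<close>

lemma has_mps_collect_le:
  fixes c :: "'i \<Rightarrow> 'b::banach" and f :: "'a::euclidean_space \<Rightarrow> 'b"
  assumes s: "0 < s" and \<alpha>: "\<alpha> ` I \<subseteq> multi_indices"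
    and w: "(w has_sum W) I" and W: "W \<le> N"
    and le: "\<And>i. i \<in> I \<Longrightarrow> norm (c i) * s ^ mdeg (\<alpha> i) \<le> w i"
    and f: "\<And>h. h \<in> cube s \<Longrightarrow> ((\<lambda>i. mpow h (\<alpha> i) *\<^sub>R c i) has_sum f (x + h)) I"
  shows "has_mps f x s N"
proof -
  have sm: "(\<lambda>i. norm (c i) * s ^ mdeg (\<alpha> i)) summable_on I"
    by (rule summable_on_comparison_test[OF has_sum_imp_summable[OF w]]) (use le s in auto)
  have "(\<Sum>\<^sub>\<infinity>i\<in>I. norm (c i) * s ^ mdeg (\<alpha> i)) \<le> W"
    by (rule has_sum_mono[OF has_sum_infsum[OF sm] w]) (use le in auto)
  then show ?thesis
    using W by (intro has_mps_collect[OF s \<alpha> has_sum_infsum[OF sm] _ f]) auto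
qed

text \<open>The product is a series indexed by pairs of exponents. As exponents add, the weight of a
  pair is the product of the two weights, and the weighted norm is submultiplicative up to
  \<open>K\<close>.\<close>

lemma has_mps_bilinear:
  fixes B :: "'b::real_normed_vector \<Rightarrow> 'c::real_normed_vector \<Rightarrow> 'd::banach"
  assumes B: "bounded_bilinear B" and K: "\<And>a b. norm (B a b) \<le> K * (norm a * norm b)" "0 \<le> K"
    and f: "has_mps f x s M" and g: "has_mps g x s N"
  shows "has_mps (\<lambda>y. B (f y) (g y)) x s (K * (M * N))"
proof -
  obtain c where c: "0 < s" "(\<lambda>\<alpha>. norm (c \<alpha>) * s ^ mdeg \<alpha>) summable_on multi_indices"
    "(\<Sum>\<^sub>\<infinity>\<alpha>\<in>multi_indices. norm (c \<alpha>) * s ^ mdeg \<alpha>) \<le> M"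
    "\<And>h. h \<in> cube s \<Longrightarrow> ((\<lambda>\<alpha>. mpow h \<alpha> *\<^sub>R c \<alpha>) has_sum f (x + h)) multi_indices"
    using f by (rule has_mpsE) blast
  obtain d where d: "(\<lambda>\<alpha>. norm (d \<alpha>) * s ^ mdeg \<alpha>) summable_on multi_indices"
    "(\<Sum>\<^sub>\<infinity>\<alpha>\<in>multi_indices. norm (d \<alpha>) * s ^ mdeg \<alpha>) \<le> N"
    "\<And>h. h \<in> cube s \<Longrightarrow> ((\<lambda>\<alpha>. mpow h \<alpha> *\<^sub>R d \<alpha>) has_sum g (x + h)) multi_indices"
    using g by (rule has_mpsE) blast
  interpret bounded_bilinear B by fact
  let ?I = "multi_indices \<times> multi_indices :: (('a \<Rightarrow> nat) \<times> ('a \<Rightarrow> nat)) set"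
  let ?\<alpha> = "\<lambda>(\<alpha>, \<beta>). (\<lambda>b\<in>Basis. \<alpha> b + \<beta> b) :: 'a \<Rightarrow> nat"
  have deg: "mdeg (\<lambda>b\<in>Basis. \<alpha> b + \<beta> b) = mdeg \<alpha> + mdeg \<beta>" for \<alpha> \<beta> :: "'a \<Rightarrow> nat"
    by (simp add: mdeg_def sum.distrib)
  have pow: "mpow h (\<lambda>b\<in>Basis. \<alpha> b + \<beta> b) = mpow h \<alpha> * mpow h \<beta>" for h and \<alpha> \<beta> :: "'a \<Rightarrow> nat"
    by (simp add: mpow_def power_add prod.distrib)
  let ?C = "\<Sum>\<^sub>\<infinity>\<alpha>\<in>multi_indices. norm (c \<alpha>) * s ^ mdeg \<alpha>"
  let ?D = "\<Sum>\<^sub>\<infinity>\<alpha>\<in>multi_indices. norm (d \<alpha>) * s ^ mdeg \<alpha>"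
  have nn: "0 \<le> ?C" "0 \<le> ?D" by (intro infsum_nonneg; use c(1) in simp)+
  show ?thesis
  proof (rule has_mps_collect_le[where I="?I" and \<alpha>="?\<alpha>" and c="\<lambda>(\<alpha>, \<beta>). B (c \<alpha>) (d \<beta>)"
        and W="K * (?C * ?D)"])
    show "0 < s" by fact
    show "?\<alpha> ` ?I \<subseteq> multi_indices" by auto
    show "((\<lambda>z. K * (case z of (\<alpha>, \<beta>) \<Rightarrow> (norm (c \<alpha>) * s ^ mdeg \<alpha>) * (norm (d \<beta>) * s ^ mdeg \<beta>)))
        has_sum K * (?C * ?D)) ?I"
      by (intro has_sum_cmult_right has_sum_product_nonneg has_sum_infsum c d) (use c(1) in auto)
    show "K * (?C * ?D) \<le> K * (M * N)"
      using c(3) d(2) nn K(2) by (intro mult_left_mono mult_mono) auto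
    fix z assume "z \<in> ?I"
    show "norm (case z of (\<alpha>, \<beta>) \<Rightarrow> B (c \<alpha>) (d \<beta>)) * s ^ mdeg (?\<alpha> z)
      \<le> K * (case z of (\<alpha>, \<beta>) \<Rightarrow> (norm (c \<alpha>) * s ^ mdeg \<alpha>) * (norm (d \<beta>) * s ^ mdeg \<beta>))"
      using mult_right_mono[OF K(1)[of "c (fst z)" "d (snd z)"], of "s ^ mdeg (fst z) * s ^ mdeg (snd z)"] c(1)
      by (simp add: case_prod_unfold deg power_add mult_ac)
  next
    fix h :: 'a assume h: "h \<in> cube s"
    have "((\<lambda>(\<alpha>, \<beta>). B (mpow h \<alpha> *\<^sub>R c \<alpha>) (mpow h \<beta> *\<^sub>R d \<beta>)) has_sum B (f (x + h)) (g (x + h))) ?I"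
      using c(4)[OF h] d(3)[OF h] h c(2) d(1)
      by (intro has_sum_bilinear[OF B] summable_on_mpow_scaleR)
    then show "((\<lambda>z. mpow h (?\<alpha> z) *\<^sub>R (case z of (\<alpha>, \<beta>) \<Rightarrow> B (c \<alpha>) (d \<beta>))) has_sum B (f (x + h)) (g (x + h))) ?I"
      by (simp add: case_prod_unfold pow scaleR_left scaleR_right mult.commute)
  qed
qed

lemma has_mps_add:
  fixes f g :: "'a::euclidean_space \<Rightarrow> 'b::banach"
  assumes f: "has_mps f x s M" and g: "has_mps g x s N"
  shows "has_mps (\<lambda>y. f y + g y) x s (M + N)"
proof -
  obtain c where c: "0 < s" "(\<lambda>\<alpha>. norm (c \<alpha>) * s ^ mdeg \<alpha>) summable_on multi_indices"
    "(\<Sum>\<^sub>\<infinity>\<alpha>\<in>multi_indices. norm (c \<alpha>) * s ^ mdeg \<alpha>) \<le> M"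
    "\<And>h. h \<in> cube s \<Longrightarrow> ((\<lambda>\<alpha>. mpow h \<alpha> *\<^sub>R c \<alpha>) has_sum f (x + h)) multi_indices"
    using f by (rule has_mpsE) blast
  obtain d where d: "(\<lambda>\<alpha>. norm (d \<alpha>) * s ^ mdeg \<alpha>) summable_on multi_indices"
    "(\<Sum>\<^sub>\<infinity>\<alpha>\<in>multi_indices. norm (d \<alpha>) * s ^ mdeg \<alpha>) \<le> N"
    "\<And>h. h \<in> cube s \<Longrightarrow> ((\<lambda>\<alpha>. mpow h \<alpha> *\<^sub>R d \<alpha>) has_sum g (x + h)) multi_indices"
    using g by (rule has_mpsE) blast
  show ?thesis
  proof (rule has_mps_collect_le[where I=multi_indices and \<alpha>="\<lambda>\<alpha>. \<alpha>" and c="\<lambda>\<alpha>. c \<alpha> + d \<alpha>"])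
    show "((\<lambda>\<alpha>. norm (c \<alpha>) * s ^ mdeg \<alpha> + norm (d \<alpha>) * s ^ mdeg \<alpha>) has_sum
      (\<Sum>\<^sub>\<infinity>\<alpha>\<in>multi_indices. norm (c \<alpha>) * s ^ mdeg \<alpha>) + (\<Sum>\<^sub>\<infinity>\<alpha>\<in>multi_indices. norm (d \<alpha>) * s ^ mdeg \<alpha>)) multi_indices"
      using c d by (intro has_sum_add has_sum_infsum)
    show "norm (c \<alpha> + d \<alpha>) * s ^ mdeg \<alpha> \<le> norm (c \<alpha>) * s ^ mdeg \<alpha> + norm (d \<alpha>) * s ^ mdeg \<alpha>" for \<alpha>
      using mult_right_mono[OF norm_triangle_ineq, of "s ^ mdeg \<alpha>" "c \<alpha>" "d \<alpha>"] c(1)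
      by (simp add: algebra_simps)
    show "((\<lambda>\<alpha>. mpow h \<alpha> *\<^sub>R (c \<alpha> + d \<alpha>)) has_sum f (x + h) + g (x + h)) multi_indices"
      if "h \<in> cube s" for h
      using has_sum_add[OF c(4)[OF that] d(3)[OF that]] by (simp add: scaleR_add_right)
  qed (use c d in auto)
qed

lemma has_mps_bounded_linear:
  fixes L :: "'b::real_normed_vector \<Rightarrow> 'c::banach"
  assumes L: "bounded_linear L" "\<And>a. norm (L a) \<le> K * norm a" "0 \<le> K"
    and f: "has_mps f x s N"
  shows "has_mps (\<lambda>y. L (f y)) x s (K * N)"
proof -
  obtain c where c: "0 < s" "(\<lambda>\<alpha>. norm (c \<alpha>) * s ^ mdeg \<alpha>) summable_on multi_indices"
    "(\<Sum>\<^sub>\<infinity>\<alpha>\<in>multi_indices. norm (c \<alpha>) * s ^ mdeg \<alpha>) \<le> N"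
    "\<And>h. h \<in> cube s \<Longrightarrow> ((\<lambda>\<alpha>. mpow h \<alpha> *\<^sub>R c \<alpha>) has_sum f (x + h)) multi_indices"
    using f by (rule has_mpsE) blast
  interpret bounded_linear L by fact
  show ?thesis
  proof (rule has_mps_collect_le[where I=multi_indices and \<alpha>="\<lambda>\<alpha>. \<alpha>" and c="\<lambda>\<alpha>. L (c \<alpha>)"])
    show "((\<lambda>\<alpha>. K * (norm (c \<alpha>) * s ^ mdeg \<alpha>)) has_sum
      K * (\<Sum>\<^sub>\<infinity>\<alpha>\<in>multi_indices. norm (c \<alpha>) * s ^ mdeg \<alpha>)) multi_indices"
      using c by (intro has_sum_cmult_right has_sum_infsum)
    show "norm (L (c \<alpha>)) * s ^ mdeg \<alpha> \<le> K * (norm (c \<alpha>) * s ^ mdeg \<alpha>)" for \<alpha>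
      using mult_right_mono[OF L(2), of "s ^ mdeg \<alpha>" "c \<alpha>"] c(1)
      by (simp add: algebra_simps)
    show "((\<lambda>\<alpha>. mpow h \<alpha> *\<^sub>R L (c \<alpha>)) has_sum L (f (x + h))) multi_indices"
      if "h \<in> cube s" for h
      using has_sum_bounded_linear[OF L(1) c(4)[OF that]] by (simp add: o_def scaleR)
  qed (use c L(3) in \<open>auto intro: mult_left_mono\<close>)
qed

lemma has_mps_mono:
  fixes f :: "'a::euclidean_space \<Rightarrow> 'b::banach"
  assumes f: "has_mps f x s M" and "0 < t" "t \<le> s" "M \<le> N"
  shows "has_mps f x t N"
proof -
  obtain c where c: "0 < s" "(\<lambda>\<alpha>. norm (c \<alpha>) * s ^ mdeg \<alpha>) summable_on multi_indices"
    "(\<Sum>\<^sub>\<infinity>\<alpha>\<in>multi_indices. norm (c \<alpha>) * s ^ mdeg \<alpha>) \<le> M"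
    "\<And>h. h \<in> cube s \<Longrightarrow> ((\<lambda>\<alpha>. mpow h \<alpha> *\<^sub>R c \<alpha>) has_sum f (x + h)) multi_indices"
    using f by (rule has_mpsE) blast
  show ?thesis
    by (rule has_mps_collect_le[where I=multi_indices and \<alpha>="\<lambda>\<alpha>. \<alpha>" and c=c, OF _ _ has_sum_infsum[OF c(2)]])
       (use assms c cube_mono[OF assms(3)] in \<open>auto intro!: mult_left_mono power_mono\<close>)
qed

lemma has_mps_zero:
  fixes x :: "'a::euclidean_space"
  shows "0 < s \<Longrightarrow> has_mps (\<lambda>_. 0 :: 'b::banach) x s 0"
  unfolding has_mps_def by (auto intro!: exI[of _ "\<lambda>_. 0"])

lemma has_mps_sum:
  fixes f :: "'i \<Rightarrow> 'a::euclidean_space \<Rightarrow> 'b::banach"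
  assumes "0 < s" "\<And>i. i \<in> A \<Longrightarrow> has_mps (f i) x s (N i)" "finite A"
  shows "has_mps (\<lambda>y. \<Sum>i\<in>A. f i y) x s (\<Sum>i\<in>A. N i)"
  using assms(3,2) by induction (auto intro: has_mps_zero has_mps_add assms(1))

lemma has_mps_norm_le:
  assumes "has_mps f x s N" "h \<in> cube s"
  shows "norm (f (x + h)) \<le> N"
proof -
  obtain c where c: "0 < s" "(\<lambda>\<alpha>. norm (c \<alpha>) * s ^ mdeg \<alpha>) summable_on multi_indices"
    "(\<Sum>\<^sub>\<infinity>\<alpha>\<in>multi_indices. norm (c \<alpha>) * s ^ mdeg \<alpha>) \<le> N"
    "\<And>h. h \<in> cube s \<Longrightarrow> ((\<lambda>\<alpha>. mpow h \<alpha> *\<^sub>R c \<alpha>) has_sum f (x + h)) multi_indices"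
    using assms(1) by (rule has_mpsE) blast
  have "norm (f (x + h)) \<le> (\<Sum>\<^sub>\<infinity>\<alpha>\<in>multi_indices. norm (c \<alpha>) * s ^ mdeg \<alpha>)"
    by (rule norm_infsum_le[OF c(4)[OF assms(2)] has_sum_infsum[OF c(2)]])
       (use abs_mpow_le[OF assms(2)] in \<open>auto simp: mult.commute[of "norm _"] intro: mult_right_mono\<close>)
  then show ?thesis using c(3) by simp
qed

lemma has_mps_nonneg: "has_mps f x s N \<Longrightarrow> 0 \<le> N"
  using has_mps_norm_le[of f x s N 0] has_mps_pos[of f x s N]
  by (auto intro: order_trans[OF norm_ge_zero])


section \<open>Recentering and differentiation\<close>

lemma mpow_add:
  "mpow (k + h) \<alpha> = (\<Sum>\<beta>\<in>(\<Pi>\<^sub>E b\<in>Basis. {..\<alpha> b}).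
     \<Prod>b\<in>Basis. of_nat (\<alpha> b choose \<beta> b) * (k \<bullet> b) ^ \<beta> b * (h \<bullet> b) ^ (\<alpha> b - \<beta> b))"
  unfolding mpow_def inner_add_left binomial_ring by (rule prod_sum_PiE) auto

text \<open>Expanding each monomial binomially gives a double series. Its absolute sum is the
  original series, with norms of coefficients, at the point with coordinates
  \<open>s + \<bar>h \<bullet> b\<bar>\<close>. That point still lies in
  \<open>cube (r + s)\<close>, so the reordering is legitimate and the bound \<open>N\<close> does
  not grow.\<close>

lemma has_mps_recenter:
  fixes f :: "'a::euclidean_space \<Rightarrow> 'b::banach"
  assumes f: "has_mps f x (r + s) N" and h: "h \<in> cube r" and s: "0 < s"
  shows "has_mps f (x + h) s N"
proof -
  obtain c where c: "0 < r + s" "(\<lambda>\<alpha>. norm (c \<alpha>) * (r + s) ^ mdeg \<alpha>) summable_on multi_indices"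
    "(\<Sum>\<^sub>\<infinity>\<alpha>\<in>multi_indices. norm (c \<alpha>) * (r + s) ^ mdeg \<alpha>) \<le> N"
    "\<And>h. h \<in> cube (r + s) \<Longrightarrow> ((\<lambda>\<alpha>. mpow h \<alpha> *\<^sub>R c \<alpha>) has_sum f (x + h)) multi_indices"
    using f by (rule has_mpsE) blast
  define B where "B \<alpha> = (\<Pi>\<^sub>E b\<in>Basis. {..\<alpha> b})" for \<alpha> :: "'a \<Rightarrow> nat"
  have finB: "finite (B \<alpha>)" for \<alpha>
    unfolding B_def by (intro finite_PiE) auto
  define p where "p k h \<alpha> \<beta> = (\<Prod>b\<in>Basis. of_nat (\<alpha> b choose \<beta> b) * (k \<bullet> b) ^ \<beta> b * (h \<bullet> b) ^ (\<alpha> b - \<beta> b))"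
    for k h :: 'a and \<alpha> \<beta>
  define q where "q \<alpha> \<beta> = (\<Prod>b\<in>Basis. of_nat (\<alpha> b choose \<beta> b) * (h \<bullet> b) ^ (\<alpha> b - \<beta> b))" for \<alpha> \<beta>
  \<comment> \<open>\<open>a\<close> and the corner \<open>o1\<close> have nonnegative coordinates,
    so every binomial term at \<open>o1 + a\<close> is nonnegative and is the absolute weight of the
    recentered term.\<close>
  define a where "a = (\<Sum>b\<in>Basis. \<bar>h \<bullet> b\<bar> *\<^sub>R b)"
  define o1 where "o1 = (\<Sum>b\<in>Basis. s *\<^sub>R b :: 'a)"
  have ab: "a \<bullet> b = \<bar>h \<bullet> b\<bar>" "o1 \<bullet> b = s" if "b \<in> Basis" for b
    unfolding a_def o1_def using that by (simp_all add: inner_sum_left_Basis)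
  have pq: "p k h \<alpha> \<beta> = mpow k \<beta> * q \<alpha> \<beta>" for k \<alpha> \<beta>
    unfolding p_def q_def mpow_def by (simp add: prod.distrib mult_ac)
  have o1p: "mpow o1 \<beta> = s ^ mdeg \<beta>" for \<beta>
    unfolding mpow_def mdeg_def by (simp add: ab power_sum)
  have sum_p: "(\<Sum>\<beta>\<in>B \<alpha>. p k h \<alpha> \<beta>) = mpow (k + h) \<alpha>" for k h \<alpha>
    unfolding p_def B_def by (rule mpow_add[symmetric])
  have pabs: "p o1 a \<alpha> \<beta> = s ^ mdeg \<beta> * \<bar>q \<alpha> \<beta>\<bar>" for \<alpha> \<beta>
    unfolding p_def q_def o1p[symmetric] mpow_def
    by (simp add: prod.distrib mult_ac abs_prod abs_mult power_abs ab)
  let ?I = "SIGMA \<alpha>:multi_indices. B \<alpha>"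
  define v where "v \<alpha> = mpow (o1 + a) \<alpha> * norm (c \<alpha>)" for \<alpha>
  have in_cube: "o1 + a \<in> cube (r + s)"
    using h s by (auto simp: cube_def ab inner_add_left)
  have v_le: "v \<alpha> \<le> norm (c \<alpha>) * (r + s) ^ mdeg \<alpha>" for \<alpha>
    unfolding v_def mult.commute[of _ "norm (c \<alpha>)"]
    using abs_mpow_le[OF in_cube, of \<alpha>] by (intro mult_left_mono) auto
  have p_nn: "0 \<le> p o1 a \<alpha> \<beta>" for \<alpha> \<beta>
    unfolding pabs using s by simp
  have v_nn: "0 \<le> v \<alpha>" for \<alpha>
    unfolding v_def sum_p[symmetric] by (intro mult_nonneg_nonneg sum_nonneg p_nn) auto
  have vs: "v summable_on multi_indices"
    by (rule summable_on_comparison_test[OF c(2)]) (use v_le v_nn in auto)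
  have inner: "((\<lambda>\<beta>. case (\<alpha>, \<beta>) of (\<alpha>, \<beta>) \<Rightarrow> p o1 a \<alpha> \<beta> * norm (c \<alpha>)) has_sum v \<alpha>) (B \<alpha>)" for \<alpha>
    unfolding v_def by (rule has_sum_finiteI[OF finB]) (simp add: sum_p[symmetric] sum_distrib_right)
  have ws: "(\<lambda>(\<alpha>, \<beta>). p o1 a \<alpha> \<beta> * norm (c \<alpha>)) summable_on ?I"
    by (rule summable_on_SigmaI[OF inner vs]) (use p_nn in auto)
  have w: "((\<lambda>(\<alpha>, \<beta>). p o1 a \<alpha> \<beta> * norm (c \<alpha>)) has_sum infsum v multi_indices) ?I"
    by (rule has_sum_SigmaI[OF inner has_sum_infsum[OF vs] ws])
  show ?thesis
  proof (rule has_mps_collect_le[OF s _ w, where \<alpha>=snd and c="\<lambda>(\<alpha>, \<beta>). q \<alpha> \<beta> *\<^sub>R c \<alpha>"])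
    show "infsum v multi_indices \<le> N"
      using infsum_mono[OF vs c(2) v_le] c(3) by simp
    show "snd ` ?I \<subseteq> multi_indices"
      by (auto simp: B_def PiE_def)
    show "norm (case z of (\<alpha>, \<beta>) \<Rightarrow> q \<alpha> \<beta> *\<^sub>R c \<alpha>) * s ^ mdeg (snd z) \<le> (case z of (\<alpha>, \<beta>) \<Rightarrow> p o1 a \<alpha> \<beta> * norm (c \<alpha>))" for z
      by (simp add: case_prod_unfold pabs mult_ac)
    fix k :: 'a assume k: "k \<in> cube s"
    have kh: "k + h \<in> cube (r + s)"
      using k h by (fastforce simp: cube_def inner_add_left)
    show "((\<lambda>z. mpow k (snd z) *\<^sub>R (case z of (\<alpha>, \<beta>) \<Rightarrow> q \<alpha> \<beta> *\<^sub>R c \<alpha>)) has_sum f (x + h + k)) ?I"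
    proof (rule has_sum_SigmaI)
      show "((\<lambda>\<alpha>. mpow (k + h) \<alpha> *\<^sub>R c \<alpha>) has_sum f (x + h + k)) multi_indices"
        using c(4)[OF kh] by (simp add: add_ac)
      show "((\<lambda>\<beta>. mpow k (snd (\<alpha>, \<beta>)) *\<^sub>R (case (\<alpha>, \<beta>) of (\<alpha>, \<beta>) \<Rightarrow> q \<alpha> \<beta> *\<^sub>R c \<alpha>)) has_sum mpow (k + h) \<alpha> *\<^sub>R c \<alpha>) (B \<alpha>)" for \<alpha>
        by (rule has_sum_finiteI[OF finB]) (simp add: sum_p[symmetric] pq scaleR_left.sum)
      show "(\<lambda>z. mpow k (snd z) *\<^sub>R (case z of (\<alpha>, \<beta>) \<Rightarrow> q \<alpha> \<beta> *\<^sub>R c \<alpha>)) summable_on ?I"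
      proof (rule abs_summable_summable[OF Infinite_Sum.abs_summable_on_comparison_test'[OF ws]])
        fix z assume "z \<in> ?I"
        show "norm (mpow k (snd z) *\<^sub>R (case z of (\<alpha>, \<beta>) \<Rightarrow> q \<alpha> \<beta> *\<^sub>R c \<alpha>)) \<le> (case z of (\<alpha>, \<beta>) \<Rightarrow> p o1 a \<alpha> \<beta> * norm (c \<alpha>))"
          using abs_mpow_le[OF k, of "snd z"]
          by (auto simp: case_prod_unfold pabs mult.assoc[symmetric] abs_mult intro!: mult_right_mono)
      qed
    qed
  qed
qed

section \<open>Termwise differentiation\<close>

lemma has_sum_difference:
  fixes f g :: "'i \<Rightarrow> 'b::real_normed_vector"
  assumes "(f has_sum a) A" "(g has_sum b) A"
  shows "((\<lambda>i. f i - g i) has_sum (a - b)) A"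
  using has_sum_add[OF assms(1), of "\<lambda>i. - g i" "- b"] assms(2) by (simp add: has_sum_uminus)

text \<open>Finitely many indices carry all but a small part of \<open>M\<close>, and there the
  derivative is that of a finite sum; for the others the mean value inequality on the convex set
  bounds the increments by \<open>M i\<close>. It serves derivatives in space and in time
  alike.\<close>

lemma has_derivative_has_sum:
  fixes F :: "'i \<Rightarrow> 'a::real_normed_vector \<Rightarrow> 'b::banach"
  assumes S: "open S" "convex S"
    and der: "\<And>i y. i \<in> I \<Longrightarrow> y \<in> S \<Longrightarrow> (F i has_derivative F' i y) (at y)"
    and bound: "\<And>i y v. i \<in> I \<Longrightarrow> y \<in> S \<Longrightarrow> norm (F' i y v) \<le> M i * norm v"
    and M: "M summable_on I" "\<And>i. i \<in> I \<Longrightarrow> 0 \<le> M i"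
    and f: "\<And>y. y \<in> S \<Longrightarrow> ((\<lambda>i. F i y) has_sum f y) I"
    and x: "x \<in> S"
  shows "(f has_derivative (\<lambda>v. \<Sum>\<^sub>\<infinity>i\<in>I. F' i x v)) (at x)"
proof -
  define f' where "f' v = (\<Sum>\<^sub>\<infinity>i\<in>I. F' i x v)" for v
  have bl: "bounded_linear (F' i x)" if "i \<in> I" for i
    using der[OF that x] by (rule has_derivative_bounded_linear)
  have sm: "((\<lambda>i. F' i x v) has_sum f' v) I" for v
    unfolding f'_def
    by (intro has_sum_infsum, rule abs_summable_summable[OF Infinite_Sum.abs_summable_on_comparison_test'[OF summable_on_cmult_left[OF M(1), of "norm v"]]])
       (use bound x in auto)
  have blf: "bounded_linear f'"
  proof (rule bounded_linear_intro)
    fix v w and r :: real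
    show "f' (v + w) = f' v + f' w"
      using has_sum_add[OF sm[of v] sm[of w]]
      by (intro has_sum_unique[OF sm]) (auto simp: linear_simps[OF bl] cong: has_sum_cong)
    show "f' (r *\<^sub>R v) = r *\<^sub>R f' v"
      using has_sum_scaleR[OF sm[of v], of r]
      by (intro has_sum_unique[OF sm]) (auto simp: linear_simps[OF bl] cong: has_sum_cong)
    show "norm (f' v) \<le> norm v * infsum M I"
      using norm_infsum_le[OF sm has_sum_cmult_right[OF has_sum_infsum[OF M(1)], of "norm v"]] bound x
      by (auto simp: mult.commute)
  qed
  have mv: "norm (F i y - F i x) \<le> M i * norm (y - x)" if "i \<in> I" "y \<in> S" for i y
  proof (rule differentiable_bound[OF S(2) _ _ \<open>y \<in> S\<close> x])
    fix z assume "z \<in> S"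
    show "(F i has_derivative F' i z) (at z within S)"
      using der[OF that(1) \<open>z \<in> S\<close>] by (rule has_derivative_at_withinI)
    show "onorm (F' i z) \<le> M i"
      by (intro onorm_bound bound M(2) that(1) \<open>z \<in> S\<close>)
  qed
  show ?thesis
    unfolding f'_def[symmetric] has_derivative_at_alt
  proof (intro conjI blf allI impI)
    fix e :: real assume e: "0 < e"
    \<comment> \<open>A tail term costs \<open>2 * M i\<close>, once for the increment and once for
      its linear part. A tail of \<open>e / 4\<close> thus contributes \<open>e / 2\<close>, and the
      finite part gets the other half.\<close>
    obtain J where J: "finite J" "J \<subseteq> I" "dist (sum M J) (infsum M I) \<le> e / 4"
      using infsum_finite_approximation[OF M(1), of "e/4"] e by auto
    have MJ: "M summable_on I - J"
      by (rule summable_on_subset_banach[OF M(1)]) auto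
    have "infsum M (I - J) = infsum M I - sum M J"
      using infsum_Diff[OF M(1) summable_on_finite[OF J(1)] J(2)] J(1) by simp
    then have tail: "infsum M (I - J) \<le> e / 4"
      using J(3) unfolding dist_real_def by linarith
    have "((\<lambda>y. \<Sum>i\<in>J. F i y) has_derivative (\<lambda>v. \<Sum>i\<in>J. F' i x v)) (at x)"
      using J(2) x by (intro has_derivative_sum der) auto
    then obtain d where d: "0 < d" "\<And>y. norm (y - x) < d \<Longrightarrow>
        norm ((\<Sum>i\<in>J. F i y) - (\<Sum>i\<in>J. F i x) - (\<Sum>i\<in>J. F' i x (y - x))) \<le> (e/2) * norm (y - x)"
      unfolding has_derivative_at_alt using e half_gt_zero by blast
    obtain d' where d': "0 < d'" "ball x d' \<subseteq> S"
      using S(1) x open_contains_ball by blast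
    have "norm (f y - f x - f' (y - x)) \<le> e * norm (y - x)" if y: "norm (y - x) < min d d'" for y
    proof -
      have yS: "y \<in> S"
        using y d'(2) by (auto simp: dist_norm norm_minus_commute)
      let ?R = "\<lambda>i. F i y - F i x - F' i x (y - x)"
      have R: "(?R has_sum (f y - f x - f' (y - x))) I"
        by (intro has_sum_difference f[OF yS] f[OF x] sm)
      have "(?R has_sum (f y - f x - f' (y - x) - sum ?R J)) (I - J)"
        by (rule has_sum_Diff[OF R has_sum_finite[OF J(1)] J(2)])
      then have "norm (f y - f x - f' (y - x) - sum ?R J) \<le> infsum M (I - J) * (2 * norm (y - x))"
      proof (rule norm_infsum_le[OF _ has_sum_cmult_left[OF has_sum_infsum[OF MJ]]])
        fix i assume i: "i \<in> I - J"
        show "norm (?R i) \<le> M i * (2 * norm (y - x))"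
          using norm_triangle_ineq4[of "F i y - F i x" "F' i x (y - x)"] mv[of i y] bound[of i x "y - x"] i yS x
          by simp
      qed
      also have "\<dots> \<le> (e / 4) * (2 * norm (y - x))"
        by (rule mult_right_mono[OF tail]) simp
      finally have "norm (f y - f x - f' (y - x) - sum ?R J) \<le> (e/2) * norm (y - x)"
        by simp
      moreover have "norm (sum ?R J) \<le> (e/2) * norm (y - x)"
        using d(2)[of y] y by (simp add: sum_subtractf)
      ultimately show ?thesis
        using norm_triangle_ineq[of "f y - f x - f' (y - x) - sum ?R J" "sum ?R J"] by (simp add: algebra_simps)
    qed
    then show "\<exists>d>0. \<forall>y. norm (y - x) < d \<longrightarrow> norm (f y - f x - f' (y - x)) \<le> e * norm (y - x)"
      using d(1) d'(1) by (intro exI[of _ "min d d'"]) auto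
  qed
qed

text \<open>\<open>s ^ n - t ^ n\<close> is \<open>s - t\<close> times a sum of \<open>n\<close>
  products of \<open>n - 1\<close> factors \<open>s\<close> or \<open>t\<close>, each at least
  \<open>t ^ (n - 1)\<close>.\<close>

lemma mult_power_le_power_diff:
  fixes s t :: real
  assumes "0 \<le> t" "t \<le> s"
  shows "real n * t ^ (n - 1) * (s - t) \<le> s ^ n - t ^ n"
proof (induction n)
  case (Suc n)
  have "t * (real n * t ^ (n - 1) * (s - t)) \<le> s * (s ^ n - t ^ n)"
    using assms by (intro mult_mono Suc) (auto intro: power_mono)
  moreover have "t * (real n * t ^ (n - 1) * (s - t)) = real n * t ^ n * (s - t)"
    by (cases n) auto
  ultimately show ?case
    by (simp add: algebra_simps)
qed simp

lemma mdeg_fun_upd_diff: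
  assumes "b \<in> Basis"
  shows "mdeg (\<alpha>(b := \<alpha> b - 1)) = mdeg \<alpha> - (if \<alpha> b = 0 then 0 else 1)"
proof -
  have "mdeg \<alpha> = \<alpha> b + sum \<alpha> (Basis - {b})" "mdeg (\<alpha>(b := \<alpha> b - 1)) = \<alpha> b - 1 + sum \<alpha> (Basis - {b})"
    unfolding mdeg_def using assms by (subst sum.remove[of _ b]; simp)+
  then show ?thesis by auto
qed

text \<open>Cauchy's estimate for one monomial: differentiation brings down
  \<open>\<alpha> b \<le> mdeg \<alpha>\<close>, and shrinking the radius from \<open>s\<close> to
  \<open>t\<close> pays for it.\<close>

lemma derivative_weight_le:
  fixes s t :: real
  assumes "0 \<le> t" "t < s" "b \<in> Basis"
  shows "real (\<alpha> b) * t ^ mdeg (\<alpha>(b := \<alpha> b - 1)) \<le> s ^ mdeg \<alpha> / (s - t)"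
proof (cases "\<alpha> b = 0")
  case False
  have "\<alpha> b \<le> mdeg \<alpha>"
    unfolding mdeg_def using assms by (intro member_le_sum) auto
  then have "real (\<alpha> b) * t ^ (mdeg \<alpha> - 1) * (s - t) \<le> real (mdeg \<alpha>) * t ^ (mdeg \<alpha> - 1) * (s - t)"
    using assms by (intro mult_right_mono) auto
  also have "\<dots> \<le> s ^ mdeg \<alpha> - t ^ mdeg \<alpha>"
    using assms by (intro mult_power_le_power_diff) auto
  also have "\<dots> \<le> s ^ mdeg \<alpha>"
    using assms by simp
  finally show ?thesis
    unfolding mdeg_fun_upd_diff[OF assms(3)] using assms False by (simp add: pos_le_divide_eq)
qed (use assms in simp)

lemma has_derivative_mpow:
  fixes x y :: "'a::euclidean_space"
  shows "((\<lambda>y. mpow (y - x) \<alpha>) has_derivative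
    (\<lambda>v. \<Sum>b\<in>Basis. (v \<bullet> b) * (real (\<alpha> b) * mpow (y - x) (\<alpha>(b := \<alpha> b - 1))))) (at y)"
proof -
  have eq: "(\<Prod>j\<in>Basis - {b}. ((y - x) \<bullet> j) ^ \<alpha> j) * (((y - x) \<bullet> b) ^ (\<alpha> b - 1)) = mpow (y - x) (\<alpha>(b := \<alpha> b - 1))"
    if "b \<in> Basis" for b
    unfolding mpow_def using that by (subst prod.remove[of _ b]) (auto intro!: prod.cong)
  have "((\<lambda>y. \<Prod>b\<in>Basis. ((y - x) \<bullet> b) ^ \<alpha> b) has_derivative
     (\<lambda>v. \<Sum>b\<in>Basis. (real (\<alpha> b) * (v \<bullet> b) * ((y - x) \<bullet> b) ^ (\<alpha> b - 1)) * (\<Prod>j\<in>Basis - {b}. ((y - x) \<bullet> j) ^ \<alpha> j))) (at y)"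
    by (rule has_derivative_prod) (auto intro!: derivative_eq_intros)
  moreover have "(\<Sum>b\<in>Basis. (real (\<alpha> b) * (v \<bullet> b) * ((y - x) \<bullet> b) ^ (\<alpha> b - 1)) * (\<Prod>j\<in>Basis - {b}. ((y - x) \<bullet> j) ^ \<alpha> j))
      = (\<Sum>b\<in>Basis. (v \<bullet> b) * (real (\<alpha> b) * mpow (y - x) (\<alpha>(b := \<alpha> b - 1))))" for v
    by (rule sum.cong) (simp_all only: eq[symmetric] mult_ac)
  ultimately show ?thesis
    by (simp only: mpow_def[of "_ - x" \<alpha>])
qed

text \<open>Open companion of \<open>cube\<close>, for derivatives taken at a point; as a
  \<open>box\<close> it is open and convex, as \<open>has_derivative_has_sum\<close>
  demands.\<close>

definition open_cube :: "'a::euclidean_space \<Rightarrow> real \<Rightarrow> 'a set" where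
  "open_cube x s = box (x - s *\<^sub>R One) (x + s *\<^sub>R One)"

lemma open_cube_iff: "y \<in> open_cube x s \<longleftrightarrow> (\<forall>b\<in>Basis. \<bar>(y - x) \<bullet> b\<bar> < s)"
  unfolding open_cube_def mem_box by (auto simp: inner_diff_left inner_add_left abs_less_iff)

lemma open_cube_simps [simp]: "open (open_cube x s)" "convex (open_cube x s)"
  by (auto simp: open_cube_def convex_box)

lemma open_cube_center [simp]: "0 < s \<Longrightarrow> x \<in> open_cube x s"
  by (simp add: open_cube_iff)

lemma open_cube_imp_cube: "y \<in> open_cube x s \<Longrightarrow> y - x \<in> cube s"
  by (force simp: open_cube_iff cube_def)

lemma cube_imp_open_cube: "h \<in> cube s \<Longrightarrow> s < t \<Longrightarrow> x + h \<in> open_cube x t"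
  by (fastforce simp: open_cube_iff cube_def)

lemma has_mps_derivative:
  fixes f :: "'a::euclidean_space \<Rightarrow> 'b::banach"
  assumes f: "has_mps f x s N" and t: "0 < t" "t < s"
  shows has_mps_differentiable: "\<And>h. h \<in> cube t \<Longrightarrow> f differentiable (at (x + h))"
    and has_mps_frechet_derivative:
      "\<And>b. b \<in> Basis \<Longrightarrow> has_mps (\<lambda>y. frechet_derivative f (at y) b) x t (N / (s - t))"
proof -
  obtain c where c: "0 < s" "(\<lambda>\<alpha>. norm (c \<alpha>) * s ^ mdeg \<alpha>) summable_on multi_indices"
    "(\<Sum>\<^sub>\<infinity>\<alpha>\<in>multi_indices. norm (c \<alpha>) * s ^ mdeg \<alpha>) \<le> N"
    "\<And>h. h \<in> cube s \<Longrightarrow> ((\<lambda>\<alpha>. mpow h \<alpha> *\<^sub>R c \<alpha>) has_sum f (x + h)) multi_indices"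
    using f by (rule has_mpsE) blast
  \<comment> \<open>The closed cube of radius \<open>t\<close> has to lie in an open set on which
    the derivative series is dominated, hence a radius strictly between \<open>t\<close> and
    \<open>s\<close>.\<close>
  define r where "r = (s + t) / 2"
  have r: "t < r" "r < s" "0 < r" using t by (auto simp: r_def)
  define D where "D h \<alpha> b = real (\<alpha> b) * mpow h (\<alpha>(b := \<alpha> b - 1))" for h \<alpha> and b :: 'a
  have D_le: "\<bar>D h \<alpha> b\<bar> \<le> s ^ mdeg \<alpha> / (s - q)" if "h \<in> cube q" "0 \<le> q" "q < s" "b \<in> Basis" for h \<alpha> b q
    using mult_left_mono[OF abs_mpow_le[OF that(1)], of "real (\<alpha> b)" "\<alpha>(b := \<alpha> b - 1)"]
      derivative_weight_le[OF that(2,3,4), of \<alpha>] by (simp add: D_def abs_mult)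
  define F' where "F' \<alpha> y v = (\<Sum>b\<in>Basis. (v \<bullet> b) * D (y - x) \<alpha> b) *\<^sub>R c \<alpha>" for \<alpha> y v
  define M where "M \<alpha> = real DIM('a) / (s - r) * (norm (c \<alpha>) * s ^ mdeg \<alpha>)" for \<alpha>
  have der: "(f has_derivative (\<lambda>v. \<Sum>\<^sub>\<infinity>\<alpha>\<in>multi_indices. F' \<alpha> y v)) (at y)" if y: "y \<in> open_cube x r" for y
  proof (rule has_derivative_has_sum[where S="open_cube x r" and F="\<lambda>\<alpha> y. mpow (y - x) \<alpha> *\<^sub>R c \<alpha>" and M=M])
    fix \<alpha> :: "'a \<Rightarrow> nat" and y v :: 'a assume y: "y \<in> open_cube x r"
    show "((\<lambda>y. mpow (y - x) \<alpha> *\<^sub>R c \<alpha>) has_derivative F' \<alpha> y) (at y)"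
      unfolding F'_def D_def by (intro has_derivative_scaleR_left has_derivative_mpow)
    have "\<bar>\<Sum>b\<in>Basis. (v \<bullet> b) * D (y - x) \<alpha> b\<bar> \<le> (\<Sum>b\<in>(Basis::'a set). norm v * (s ^ mdeg \<alpha> / (s - r)))"
      by (intro order_trans[OF sum_abs] sum_mono, unfold abs_mult)
         (intro mult_mono Basis_le_norm D_le open_cube_imp_cube[OF y] less_imp_le[OF r(3)] r(2); simp)
    then have "norm (F' \<alpha> y v) \<le> (\<Sum>b\<in>(Basis::'a set). norm v * (s ^ mdeg \<alpha> / (s - r))) * norm (c \<alpha>)"
      unfolding F'_def norm_scaleR by (intro mult_right_mono) auto
    then show "norm (F' \<alpha> y v) \<le> M \<alpha> * norm v"
      by (simp add: M_def mult_ac)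
  next
    show "M summable_on multi_indices"
      unfolding M_def by (intro summable_on_cmult_right c)
    show "0 \<le> M \<alpha>" for \<alpha>
      unfolding M_def using r c(1) by simp
    fix y :: 'a assume "y \<in> open_cube x r"
    then have "y - x \<in> cube s"
      using open_cube_imp_cube cube_mono[of r s] r by auto
    from c(4)[OF this] show "((\<lambda>\<alpha>. mpow (y - x) \<alpha> *\<^sub>R c \<alpha>) has_sum f y) multi_indices"
      by simp
  qed (use y in auto)
  show diff: "f differentiable (at (x + h))" if "h \<in> cube t" for h
    using der[OF cube_imp_open_cube[OF that r(1)]] by (auto simp: differentiable_def)
  fix b :: 'a assume b: "b \<in> Basis"
  show "has_mps (\<lambda>y. frechet_derivative f (at y) b) x t (N / (s - t))"
  \<comment> \<open>Exponents with \<open>\<alpha> b = 0\<close> and \<open>\<alpha> b = 1\<close>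
    can have the same image, the former with coefficient zero; the form with repeated monomials
    absorbs this collision.\<close>
  proof (rule has_mps_collect_le[where I=multi_indices and \<alpha>="\<lambda>\<alpha>. \<alpha>(b := \<alpha> b - 1)" and c="\<lambda>\<alpha>. real (\<alpha> b) *\<^sub>R c \<alpha>"])
    show "((\<lambda>\<alpha>. (norm (c \<alpha>) * s ^ mdeg \<alpha>) * inverse (s - t)) has_sum
       (\<Sum>\<^sub>\<infinity>\<alpha>\<in>multi_indices. norm (c \<alpha>) * s ^ mdeg \<alpha>) * inverse (s - t)) multi_indices"
      by (intro has_sum_cmult_left has_sum_infsum c)
    show "(\<Sum>\<^sub>\<infinity>\<alpha>\<in>multi_indices. norm (c \<alpha>) * s ^ mdeg \<alpha>) * inverse (s - t) \<le> N / (s - t)"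
      using c(3) t by (simp add: divide_inverse mult_right_mono)
    show "(\<lambda>\<alpha>. \<alpha>(b := \<alpha> b - 1)) ` multi_indices \<subseteq> multi_indices"
      using b by (auto simp: PiE_def extensional_def)
    show "norm (real (\<alpha> b) *\<^sub>R c \<alpha>) * t ^ mdeg (\<alpha>(b := \<alpha> b - 1)) \<le> norm (c \<alpha>) * s ^ mdeg \<alpha> * inverse (s - t)" for \<alpha>
      using mult_left_mono[OF derivative_weight_le[OF less_imp_le[OF t(1)] t(2) b, of \<alpha>], of "norm (c \<alpha>)"]
      by (simp add: mult_ac divide_inverse)
    fix h :: 'a assume h: "h \<in> cube t"
    have "frechet_derivative f (at (x + h)) b = (\<Sum>\<^sub>\<infinity>\<alpha>\<in>multi_indices. F' \<alpha> (x + h) b)"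
      using frechet_derivative_at[OF der[OF cube_imp_open_cube[OF h r(1)]]] by metis
    moreover have F'b: "F' \<alpha> (x + h) b = D h \<alpha> b *\<^sub>R c \<alpha>" for \<alpha>
    proof -
      have "(\<Sum>b'\<in>Basis. (b \<bullet> b') * D h \<alpha> b') = (\<Sum>b'\<in>Basis. if b' = b then D h \<alpha> b else 0)"
        by (rule sum.cong) (use b in \<open>auto simp: inner_Basis\<close>)
      then show ?thesis
        unfolding F'_def using b by simp
    qed
    moreover have "(\<lambda>\<alpha>. D h \<alpha> b *\<^sub>R c \<alpha>) summable_on multi_indices"
    proof (rule abs_summable_summable[OF Infinite_Sum.abs_summable_on_comparison_test'[OF summable_on_cmult_left[OF c(2), of "inverse (s - t)"]]])
      show "norm (D h \<alpha> b *\<^sub>R c \<alpha>) \<le> norm (c \<alpha>) * s ^ mdeg \<alpha> * inverse (s - t)" for \<alpha>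
        using mult_left_mono[OF D_le[OF h _ t(2) b, of \<alpha>], of "norm (c \<alpha>)"] t by (simp add: divide_inverse mult_ac)
    qed
    ultimately have "((\<lambda>\<alpha>. D h \<alpha> b *\<^sub>R c \<alpha>) has_sum frechet_derivative f (at (x + h)) b) multi_indices"
      by (simp add: has_sum_infsum)
    then show "((\<lambda>\<alpha>. mpow h (\<alpha>(b := \<alpha> b - 1)) *\<^sub>R real (\<alpha> b) *\<^sub>R c \<alpha>) has_sum frechet_derivative f (at (x + h)) b) multi_indices"
      by (simp add: D_def mult.commute)
  qed fact
qed

section \<open>Passage to and from \<open>real_analytic_at\<close>\<close>

lemma summable_on_sum_finite:
  fixes g :: "'j \<Rightarrow> 'i \<Rightarrow> 'b::banach"
  assumes "finite B" "\<And>b. b \<in> B \<Longrightarrow> g b summable_on A"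
  shows "(\<lambda>i. \<Sum>b\<in>B. g b i) summable_on A"
  using assms by induction (auto intro: summable_on_add)

text \<open>In finite dimension unconditional convergence is absolute: this holds for each real
  coordinate, and the norm is at most the sum of their absolute values.\<close>

lemma summable_on_imp_norm_summable_on:
  fixes f :: "'i \<Rightarrow> 'b::euclidean_space"
  assumes "f summable_on A"
  shows "(\<lambda>i. norm (f i)) summable_on A"
proof (rule Infinite_Sum.abs_summable_on_comparison_test')
  show "(\<lambda>i. \<Sum>b\<in>Basis. \<bar>f i \<bullet> b\<bar>) summable_on A"
  proof (rule summable_on_sum_finite)
    fix b :: 'b
    have "(\<lambda>i. f i \<bullet> b) summable_on A"
      using summable_on_bounded_linear[OF bounded_linear_inner_left assms, of b] by (simp add: o_def)
    then show "(\<lambda>i. \<bar>f i \<bullet> b\<bar>) summable_on A"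
      using summable_on_iff_abs_summable_on_real by fastforce
  qed simp
qed (rule norm_le_l1)

lemma cube_norm_le:
  fixes h :: "'a::euclidean_space"
  assumes "h \<in> cube s"
  shows "norm h \<le> real DIM('a) * s"
  using order_trans[OF norm_le_l1 sum_mono[OF cubeD[OF assms]]] by simp

text \<open>At the corner \<open>s *\<^sub>R One\<close> every monomial equals
  \<open>s ^ mdeg \<alpha>\<close>, so convergence at this single point already makes the weighted
  norm finite. The factor \<open>2 * DIM('a)\<close> fits the cube into the ball of
  convergence.\<close>

lemma real_analytic_at_imp_has_mps:
  fixes f :: "'a::euclidean_space \<Rightarrow> 'b::euclidean_space"
  assumes "real_analytic_at f x"
  obtains s N where "has_mps f x s N"
proof -
  obtain r c where r: "0 < r" and c: "\<And>y. y \<in> ball x r \<Longrightarrow>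
      ((\<lambda>\<alpha>. mpow (y - x) \<alpha> *\<^sub>R c \<alpha>) has_sum f y) multi_indices"
    using assms unfolding real_analytic_at_def mpow_def by blast
  define s where "s = r / (2 * DIM('a))"
  have s: "0 < s" "real DIM('a) * s < r"
    using r by (auto simp: s_def)
  have c': "((\<lambda>\<alpha>. mpow h \<alpha> *\<^sub>R c \<alpha>) has_sum f (x + h)) multi_indices" if "h \<in> cube s" for h
    using c[of "x + h"] cube_norm_le[OF that] s(2) by (simp add: dist_norm)
  have "s *\<^sub>R One \<in> cube s"
    using s by (simp add: cube_def)
  from has_sum_imp_summable[OF c'[OF this]]
  have "(\<lambda>\<alpha>. norm (mpow (s *\<^sub>R One) \<alpha> *\<^sub>R c \<alpha>)) summable_on multi_indices"
    by (rule summable_on_imp_norm_summable_on)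
  moreover have "mpow (s *\<^sub>R One) \<alpha> = s ^ mdeg \<alpha>" for \<alpha> :: "'a \<Rightarrow> nat"
    by (simp add: mpow_def mdeg_def power_sum)
  ultimately have "(\<lambda>\<alpha>. norm (c \<alpha>) * s ^ mdeg \<alpha>) summable_on multi_indices"
    using s by (simp add: mult.commute)
  then have "has_mps f x s (\<Sum>\<^sub>\<infinity>\<alpha>\<in>multi_indices. norm (c \<alpha>) * s ^ mdeg \<alpha>)"
    unfolding has_mps_def using s c' by blast
  then show ?thesis by (rule that)
qed

lemma has_mps_imp_real_analytic_at:
  assumes "has_mps f x s N"
  shows "real_analytic_at f x"
proof -
  obtain c where c: "0 < s" 
    "\<And>h. h \<in> cube s \<Longrightarrow> ((\<lambda>\<alpha>. mpow h \<alpha> *\<^sub>R c \<alpha>) has_sum f (x + h)) multi_indices"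
    using assms by (rule has_mpsE) blast
  have "((\<lambda>\<alpha>. mpow (y - x) \<alpha> *\<^sub>R c \<alpha>) has_sum f y) multi_indices" if "y \<in> ball x s" for y
    using c(2)[OF ball_subset_cube, of "y - x"] that by (simp add: dist_norm norm_minus_commute)
  then show ?thesis
    unfolding real_analytic_at_def using c(1)
    by (intro exI[of _ s] conjI exI[of _ c]) (auto simp: mpow_def)
qed


section \<open>Power series in time\<close>

lemma Basis_real_prod: "(Basis :: (real \<times> 'a::euclidean_space) set) = insert (1, 0) (Pair 0 ` Basis)"
  by (auto simp: Basis_prod_def)

lemma prod_Basis_real_prod:
  "(\<Prod>z\<in>(Basis :: (real \<times> 'a::euclidean_space) set). f z) = f (1, 0) * (\<Prod>b\<in>Basis. f (0, b))"
  unfolding Basis_real_prod by (subst prod.insert) (auto simp: prod.reindex inj_on_def)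

lemma sum_Basis_real_prod:
  "(\<Sum>z\<in>(Basis :: (real \<times> 'a::euclidean_space) set). f z) = f (1, 0) + (\<Sum>b\<in>Basis. f (0, b))"
  unfolding Basis_real_prod by (subst sum.insert) (auto simp: sum.reindex inj_on_def)

lemma cube_real_prod: "(t, h) \<in> cube s \<longleftrightarrow> \<bar>t\<bar> \<le> s \<and> h \<in> cube s"
  by (auto simp: cube_def Basis_real_prod)

definition time_exponent :: "(real \<times> 'a::euclidean_space \<Rightarrow> nat) \<Rightarrow> nat" where
  "time_exponent \<gamma> = \<gamma> (1, 0)"

definition space_exponent :: "(real \<times> 'a::euclidean_space \<Rightarrow> nat) \<Rightarrow> 'a \<Rightarrow> nat" where
  "space_exponent \<gamma> = (\<lambda>b\<in>Basis. \<gamma> (0, b))"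

lemma mpow_real_prod: "mpow (t, h) \<gamma> = t ^ time_exponent \<gamma> * mpow h (space_exponent \<gamma>)"
  by (simp add: mpow_def prod_Basis_real_prod time_exponent_def space_exponent_def)

lemma mdeg_real_prod: "mdeg \<gamma> = time_exponent \<gamma> + mdeg (space_exponent \<gamma>)"
  by (simp add: mdeg_def sum_Basis_real_prod time_exponent_def space_exponent_def)

lemma space_exponent_multi_index [simp]: "space_exponent \<gamma> \<in> multi_indices"
  by (simp add: space_exponent_def)

definition join_exponents :: "nat \<Rightarrow> ('a::euclidean_space \<Rightarrow> nat) \<Rightarrow> real \<times> 'a \<Rightarrow> nat" where
  "join_exponents n \<beta> = (\<lambda>z\<in>Basis. if z = (1, 0) then n else \<beta> (snd z))"

lemma time_exponent_join [simp]: "time_exponent (join_exponents n \<beta>) = n"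
  by (simp add: time_exponent_def join_exponents_def Basis_real_prod)

lemma space_exponent_join [simp]: "\<beta> \<in> multi_indices \<Longrightarrow> space_exponent (join_exponents n \<beta>) = \<beta>"
  by (force simp: space_exponent_def join_exponents_def Basis_real_prod PiE_def extensional_def fun_eq_iff)

lemma join_exponents_multi_index [simp]: "join_exponents n \<beta> \<in> multi_indices"
  by (simp add: join_exponents_def)

text \<open>Monomials are grouped by their power of time. The resulting \<open>b\<close> and
  \<open>M\<close> meet exactly the assumptions of \<open>time_series\<close>; this is how time
  coefficients are read off from an arbitrary analytic solution.\<close>

lemma has_mps_time_slices:
  fixes g :: "real \<times> 'a::euclidean_space \<Rightarrow> 'b::banach"
  assumes "has_mps g (t0, x) s N"
  obtains b M where "\<And>n. has_mps (b n) x s (M n)" "(\<lambda>n. M n * s ^ n) summable_on UNIV"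
    "\<And>t h. \<bar>t\<bar> \<le> s \<Longrightarrow> h \<in> cube s \<Longrightarrow> ((\<lambda>n. t ^ n *\<^sub>R b n (x + h)) has_sum g (t0 + t, x + h)) UNIV"
proof -
  obtain c where c: "0 < s" "(\<lambda>\<gamma>. norm (c \<gamma>) * s ^ mdeg \<gamma>) summable_on multi_indices"
    "\<And>h. h \<in> cube s \<Longrightarrow> ((\<lambda>\<gamma>. mpow h \<gamma> *\<^sub>R c \<gamma>) has_sum g ((t0, x) + h)) multi_indices"
    using assms by (rule has_mpsE) blast
  define I where "I n = {\<gamma> \<in> multi_indices. time_exponent (\<gamma> :: real \<times> 'a \<Rightarrow> nat) = n}" for n
  define w where "w \<gamma> = norm (c \<gamma>) * s ^ mdeg (space_exponent \<gamma>)" for \<gamma>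
  define b where "b n y = (\<Sum>\<^sub>\<infinity>\<gamma>\<in>I n. mpow (y - x) (space_exponent \<gamma>) *\<^sub>R c \<gamma>)" for n y
  define M where "M n = infsum w (I n)" for n
  have eq: "norm (c \<gamma>) * s ^ mdeg \<gamma> = w \<gamma> * s ^ n" if "\<gamma> \<in> I n" for \<gamma> n
    using that by (simp add: I_def w_def mdeg_real_prod power_add)
  have sI: "(\<lambda>\<gamma>. norm (c \<gamma>) * s ^ mdeg \<gamma>) summable_on I n" for n
    by (rule summable_on_subset_banach[OF c(2)]) (auto simp: I_def)
  have ws: "w summable_on I n" for n
  proof -
    have "(\<lambda>\<gamma>. norm (c \<gamma>) * s ^ mdeg \<gamma> * inverse (s ^ n)) summable_on I n"
      by (rule summable_on_cmult_left[OF sI])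
    then show ?thesis
      by (subst (asm) summable_on_cong[where g=w]) (use c(1) in \<open>auto simp: eq\<close>)
  qed
  have bs: "((\<lambda>\<gamma>. mpow h (space_exponent \<gamma>) *\<^sub>R c \<gamma>) has_sum b n (x + h)) (I n)" if "h \<in> cube s" for n h
  proof -
    have "(\<lambda>\<gamma>. mpow h (space_exponent \<gamma>) *\<^sub>R c \<gamma>) summable_on I n"
      using ws[of n] unfolding w_def
      by (intro abs_summable_summable[OF summable_on_mpow_scaleR[OF _ that]])
    then show ?thesis
      unfolding b_def by (simp add: has_sum_infsum)
  qed
  have "has_mps (b n) x s (M n)" for n
    by (rule has_mps_collect[OF c(1) _ has_sum_infsum[OF ws[unfolded w_def]] _ bs])
       (simp_all add: image_subset_iff M_def w_def[abs_def])
  moreover have "(\<lambda>n. M n * s ^ n) summable_on UNIV"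
  proof -
    have "(\<lambda>n. \<Sum>\<^sub>\<infinity>\<gamma>\<in>I n. norm (c \<gamma>) * s ^ mdeg \<gamma>) summable_on UNIV"
      using has_sum_fibers_infsum[OF has_sum_infsum[OF c(2)], of time_exponent UNIV]
      unfolding I_def by (auto intro: has_sum_imp_summable)
    moreover have "(\<Sum>\<^sub>\<infinity>\<gamma>\<in>I n. norm (c \<gamma>) * s ^ mdeg \<gamma>) = M n * s ^ n" for n
      unfolding M_def infsum_cmult_left'[symmetric] by (rule infsum_cong) (rule eq)
    ultimately show ?thesis by simp
  qed
  moreover have "((\<lambda>n. t ^ n *\<^sub>R b n (x + h)) has_sum g (t0 + t, x + h)) UNIV"
    if "\<bar>t\<bar> \<le> s" "h \<in> cube s" for t h
  proof -
    have "((\<lambda>\<gamma>. mpow (t, h) \<gamma> *\<^sub>R c \<gamma>) has_sum g (t0 + t, x + h)) multi_indices"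
      using c(3)[of "(t, h)"] that by (simp add: cube_real_prod)
    then show ?thesis
    proof (rule has_sum_fibers[where p=time_exponent])
      fix n
      have "((\<lambda>\<gamma>. t ^ n *\<^sub>R mpow h (space_exponent \<gamma>) *\<^sub>R c \<gamma>) has_sum t ^ n *\<^sub>R b n (x + h)) (I n)"
        by (rule has_sum_scaleR[OF bs[OF that(2)]])
      then show "((\<lambda>\<gamma>. mpow (t, h) \<gamma> *\<^sub>R c \<gamma>) has_sum t ^ n *\<^sub>R b n (x + h)) {\<gamma> \<in> multi_indices. time_exponent \<gamma> = n}"
        unfolding I_def by (subst has_sum_cong) (auto simp: mpow_real_prod)
    qed auto
  qed
  ultimately show ?thesis by (rule that)
qed

text \<open>Common setting for the coefficients sliced from a given solution and for those built by
  \<open>time_coeff\<close>. One radius \<open>s\<close> serves both space and time.\<close>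

locale time_series =
  fixes b :: "nat \<Rightarrow> 'a::euclidean_space \<Rightarrow> 'b::banach" and x :: 'a and s :: real and N :: "nat \<Rightarrow> real"
  assumes mps: "\<And>n. has_mps (b n) x s (N n)"
    and summable_weights: "(\<lambda>n. N n * s ^ n) summable_on UNIV"
begin

text \<open>The value involves only \<open>b\<close>, not \<open>x\<close>, \<open>s\<close> or
  \<open>N\<close>, so one global function can be studied near every base point by changing the
  locale instance.\<close>

definition val :: "real \<Rightarrow> 'a \<Rightarrow> 'b" where
  "val t y = (\<Sum>\<^sub>\<infinity>n. t ^ n *\<^sub>R b n y)"

lemma s_pos: "0 < s"
  using mps has_mps_pos by blast

lemma N_nonneg: "0 \<le> N n"
  using mps has_mps_nonneg by blast

lemma norm_coeff_le: "y - x \<in> cube s \<Longrightarrow> norm (b n y) \<le> N n"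
  using has_mps_norm_le[OF mps, of "y - x"] by simp

lemma summable_norm:
  assumes "\<bar>t\<bar> \<le> s" "y - x \<in> cube s"
  shows "(\<lambda>n. norm (t ^ n *\<^sub>R b n y)) summable_on UNIV"
proof (rule Infinite_Sum.abs_summable_on_comparison_test'[OF summable_weights])
  show "norm (t ^ n *\<^sub>R b n y) \<le> N n * s ^ n" for n
    using mult_mono[OF norm_coeff_le[OF assms(2), of n] power_mono[OF assms(1), of n]] N_nonneg
    by (simp add: power_abs mult.commute)
qed

lemma has_sum_val:
  assumes "\<bar>t\<bar> \<le> s" "y - x \<in> cube s"
  shows "((\<lambda>n. t ^ n *\<^sub>R b n y) has_sum val t y) UNIV"
  unfolding val_def by (rule has_sum_infsum[OF abs_summable_summable[OF summable_norm[OF assms]]])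

text \<open>Converse of the slicing, giving joint analyticity: pairs \<open>(n, \<alpha>)\<close>
  index the monomials of space-time through \<open>join_exponents\<close>, and the weights for fixed
  \<open>n\<close> add up to at most \<open>N n * s ^ n\<close>.\<close>

lemma has_mps_val: "has_mps (\<lambda>(t, y). val t y) (0, x) s (\<Sum>\<^sub>\<infinity>n. N n * s ^ n)"
proof -
  define P where "P n c \<longleftrightarrow> (\<lambda>\<alpha>. norm (c \<alpha>) * s ^ mdeg \<alpha>) summable_on multi_indices \<and>
    (\<Sum>\<^sub>\<infinity>\<alpha>\<in>multi_indices. norm (c \<alpha>) * s ^ mdeg \<alpha>) \<le> N n \<and>
    (\<forall>h\<in>cube s. ((\<lambda>\<alpha>. mpow h \<alpha> *\<^sub>R c \<alpha>) has_sum b n (x + h)) multi_indices)" for n and c :: "('a \<Rightarrow> nat) \<Rightarrow> 'b"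
  have "\<exists>c. P n c" for n
    using mps[of n] unfolding has_mps_def P_def by blast
  then obtain c where "P n (c n)" for n
    using choice[of P] by blast
  then have c: "\<And>n. (\<lambda>\<alpha>. norm (c n \<alpha>) * s ^ mdeg \<alpha>) summable_on multi_indices"
    "\<And>n. (\<Sum>\<^sub>\<infinity>\<alpha>\<in>multi_indices. norm (c n \<alpha>) * s ^ mdeg \<alpha>) \<le> N n"
    "\<And>n h. h \<in> cube s \<Longrightarrow> ((\<lambda>\<alpha>. mpow h \<alpha> *\<^sub>R c n \<alpha>) has_sum b n (x + h)) multi_indices"
    unfolding P_def by simp_all
  let ?I = "(UNIV :: nat set) \<times> (multi_indices :: ('a \<Rightarrow> nat) set)"
  define w where "w n \<alpha> = norm (c n \<alpha>) * s ^ mdeg \<alpha> * s ^ n" for n \<alpha>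
  define W where "W n = (\<Sum>\<^sub>\<infinity>\<alpha>\<in>multi_indices. norm (c n \<alpha>) * s ^ mdeg \<alpha>) * s ^ n" for n
  have W_nn: "0 \<le> W n" for n
    unfolding W_def using s_pos by (intro mult_nonneg_nonneg infsum_nonneg) auto
  have W_le: "W n \<le> N n * s ^ n" for n
    unfolding W_def using c(2) s_pos by (intro mult_right_mono) auto
  have Ws: "W summable_on UNIV"
    by (rule summable_on_comparison_test[OF summable_weights W_le W_nn])
  have inner: "((\<lambda>\<alpha>. case (n, \<alpha>) of (n, \<alpha>) \<Rightarrow> w n \<alpha>) has_sum W n) multi_indices" for n
    unfolding w_def W_def prod.case by (rule has_sum_cmult_left[OF has_sum_infsum[OF c(1)]])
  have ws: "(\<lambda>(n, \<alpha>). w n \<alpha>) summable_on ?I"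
    by (rule summable_on_SigmaI[OF inner Ws]) (use s_pos in \<open>auto simp: w_def\<close>)
  show ?thesis
  proof (rule has_mps_collect_le[where I="?I" and \<alpha>="\<lambda>(n, \<alpha>). join_exponents n \<alpha>" and c="\<lambda>(n, \<alpha>). c n \<alpha>"])
    show "((\<lambda>(n, \<alpha>). w n \<alpha>) has_sum infsum W UNIV) ?I"
      by (rule has_sum_SigmaI[OF inner has_sum_infsum[OF Ws] ws])
    show "infsum W UNIV \<le> (\<Sum>\<^sub>\<infinity>n. N n * s ^ n)"
      by (rule infsum_mono[OF Ws summable_weights W_le])
    show "norm (case z of (n, \<alpha>) \<Rightarrow> c n \<alpha>) * s ^ mdeg (case z of (n, \<alpha>) \<Rightarrow> join_exponents n \<alpha>) \<le> (case z of (n, \<alpha>) \<Rightarrow> w n \<alpha>)"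
      if "z \<in> ?I" for z
      using that by (auto simp: w_def mdeg_real_prod power_add)
    fix k :: "real \<times> 'a" assume k: "k \<in> cube s"
    obtain t h where th: "k = (t, h)" by (cases k)
    have t: "\<bar>t\<bar> \<le> s" and h: "h \<in> cube s"
      using k by (simp_all add: th cube_real_prod)
    have "((\<lambda>z. (t ^ fst z * mpow h (snd z)) *\<^sub>R c (fst z) (snd z)) has_sum val t (x + h)) ?I"
    proof (rule has_sum_SigmaI)
      show "((\<lambda>n. t ^ n *\<^sub>R b n (x + h)) has_sum val t (x + h)) UNIV"
        by (rule has_sum_val) (use t h in auto)
      show "((\<lambda>\<alpha>. (t ^ fst (n, \<alpha>) * mpow h (snd (n, \<alpha>))) *\<^sub>R c (fst (n, \<alpha>)) (snd (n, \<alpha>))) has_sum t ^ n *\<^sub>R b n (x + h)) multi_indices" for n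
        using has_sum_scaleR[OF c(3)[OF h, of n], of "t ^ n"] by simp
      show "(\<lambda>z. (t ^ fst z * mpow h (snd z)) *\<^sub>R c (fst z) (snd z)) summable_on ?I"
      proof (rule abs_summable_summable[OF Infinite_Sum.abs_summable_on_comparison_test'[OF ws]])
        fix z :: "nat \<times> ('a \<Rightarrow> nat)"
        have "\<bar>t\<bar> ^ fst z * \<bar>mpow h (snd z)\<bar> \<le> s ^ fst z * s ^ mdeg (snd z)"
          using s_pos by (intro mult_mono power_mono t abs_mpow_le[OF h]) auto
        from mult_right_mono[OF this norm_ge_zero[of "c (fst z) (snd z)"]]
        show "norm ((t ^ fst z * mpow h (snd z)) *\<^sub>R c (fst z) (snd z)) \<le> (case z of (n, \<alpha>) \<Rightarrow> w n \<alpha>)"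
          by (simp add: w_def case_prod_unfold abs_mult power_abs mult_ac)
      qed
    qed
    then have "((\<lambda>z. mpow k (case z of (n, \<alpha>) \<Rightarrow> join_exponents n \<alpha>) *\<^sub>R (case z of (n, \<alpha>) \<Rightarrow> c n \<alpha>)) has_sum
        val t (x + h)) ?I"
      by (rule has_sum_cong[THEN iffD1, rotated]) (auto simp: th mpow_real_prod)
    then show "((\<lambda>z. mpow k (case z of (n, \<alpha>) \<Rightarrow> join_exponents n \<alpha>) *\<^sub>R (case z of (n, \<alpha>) \<Rightarrow> c n \<alpha>)) has_sum
        (case (0, x) + k of (t, y) \<Rightarrow> val t y)) ?I"
      by (simp add: th)
  qed (use s_pos in \<open>simp_all add: image_subset_iff case_prod_unfold\<close>)
qed

lemma has_vector_derivative_val: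
  assumes t: "\<bar>t\<bar> < s" and y: "y - x \<in> cube s"
  obtains D where "((\<lambda>t. val t y) has_vector_derivative D) (at t)"
    "((\<lambda>n. t ^ n *\<^sub>R (real (Suc n) *\<^sub>R b (Suc n) y)) has_sum D) UNIV"
proof -
  define r where "r = (\<bar>t\<bar> + s) / 2"
  have r: "\<bar>t\<bar> < r" "r < s" "0 < r" using t s_pos by (auto simp: r_def)
  define F' where "F' n t v = (v * (real n * t ^ (n - 1))) *\<^sub>R b n y" for n t v
  define M where "M n = N n * s ^ n * inverse (s - r)" for n
  have le: "norm (F' n q v) \<le> M n * norm v" if "\<bar>q\<bar> < r" for n q v
  proof -
    have "real n * r ^ (n - 1) * (s - r) \<le> s ^ n"
      using mult_power_le_power_diff[of r s n] r zero_le_power[of r n] by linarith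
    then have "real n * r ^ (n - 1) \<le> s ^ n * inverse (s - r)"
      using r by (simp add: field_simps)
    moreover have "real n * \<bar>q\<bar> ^ (n - 1) \<le> real n * r ^ (n - 1)"
      using that by (intro mult_left_mono power_mono) auto
    ultimately have "real n * \<bar>q\<bar> ^ (n - 1) \<le> s ^ n * inverse (s - r)" by linarith
    then have "(real n * \<bar>q\<bar> ^ (n - 1)) * norm (b n y) \<le> (s ^ n * inverse (s - r)) * N n"
      by (rule mult_mono[OF _ norm_coeff_le[OF y]]) (use r s_pos in auto)
    then have "\<bar>v\<bar> * ((real n * \<bar>q\<bar> ^ (n - 1)) * norm (b n y)) \<le> \<bar>v\<bar> * ((s ^ n * inverse (s - r)) * N n)"
      by (rule mult_left_mono) simp
    then show ?thesis
      by (simp add: F'_def M_def abs_mult power_abs mult_ac)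
  qed
  have Ms: "M summable_on UNIV"
    unfolding M_def by (rule summable_on_cmult_left[OF summable_weights])
  have der: "((\<lambda>t. val t y) has_derivative (\<lambda>v. \<Sum>\<^sub>\<infinity>n. F' n t v)) (at t)"
  proof (rule has_derivative_has_sum[where S="{-r<..<r}" and F="\<lambda>n t. t ^ n *\<^sub>R b n y" and M=M])
    fix n q v assume q: "q \<in> {-r<..<r}"
    show "((\<lambda>t. t ^ n *\<^sub>R b n y) has_derivative F' n q) (at q)"
      unfolding F'_def by (auto intro!: derivative_eq_intros simp: fun_eq_iff mult_ac)
    show "norm (F' n q v) \<le> M n * norm v"
      using le q by auto
    show "((\<lambda>n. q ^ n *\<^sub>R b n y) has_sum val q y) UNIV"
      using q r by (intro has_sum_val y) auto
  next
    show "0 \<le> M n" for n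
      using le[of 0 n 1] r by (auto intro: order_trans[OF norm_ge_zero])
  qed (use Ms r in auto)
  define D where "D = (\<Sum>\<^sub>\<infinity>n. F' n t 1)"
  have F'1: "F' n t v = v *\<^sub>R F' n t 1" for n v
    by (simp add: F'_def)
  have "(\<Sum>\<^sub>\<infinity>n. F' n t v) = v *\<^sub>R D" for v
    unfolding D_def by (subst F'1) (rule infsum_scaleR_right)
  then have vd: "((\<lambda>t. val t y) has_vector_derivative D) (at t)"
    using der by (simp add: has_vector_derivative_def)
  have "(\<lambda>n. F' n t 1) summable_on UNIV"
    by (rule abs_summable_summable[OF Infinite_Sum.abs_summable_on_comparison_test'[OF Ms]])
       (use le[of t _ 1] r in auto)
  then have "((\<lambda>n. F' n t 1) has_sum D) UNIV"
    unfolding D_def by (rule has_sum_infsum)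
  \<comment> \<open>The term \<open>n = 0\<close> carries the factor \<open>real 0\<close>; dropping
    it allows the reindexing by \<open>Suc\<close>.\<close>
  also have "?this \<longleftrightarrow> ((\<lambda>n. F' n t 1) has_sum D) (range Suc)"
    by (rule has_sum_cong_neutral) (auto simp: F'_def image_iff gr0_conv_Suc dest: not0_implies_Suc)
  also have "\<dots> \<longleftrightarrow> ((\<lambda>n. t ^ n *\<^sub>R (real (Suc n) *\<^sub>R b (Suc n) y)) has_sum D) UNIV"
    by (subst has_sum_reindex) (auto simp: o_def F'_def mult_ac)
  finally show ?thesis
    using that vd by blast
qed

lemma has_derivative_val:
  assumes t: "\<bar>t\<bar> \<le> s" and y: "y \<in> open_cube x s"
  shows "(val t has_derivative (\<lambda>v. \<Sum>\<^sub>\<infinity>n. t ^ n *\<^sub>R frechet_derivative (b n) (at y) v)) (at y)"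
    and "\<And>v. ((\<lambda>n. t ^ n *\<^sub>R frechet_derivative (b n) (at y) v) has_sum frechet_derivative (val t) (at y) v) UNIV"
proof -
  obtain r where r: "r < s" "0 < r" "y \<in> open_cube x r"
  proof -
    \<comment> \<open>The distance from \<open>x\<close> to \<open>y\<close> in the maximum norm,
      kept at least \<open>s / 2\<close> so that the radius chosen between \<open>q\<close> and
      \<open>s\<close> is positive.\<close>
    define q where "q = Max (insert (s/2) ((\<lambda>b. \<bar>(y - x) \<bullet> b\<bar>) ` Basis))"
    have "q < s"
      unfolding q_def using y s_pos by (subst Max_less_iff) (auto simp: open_cube_iff)
    moreover have "s / 2 \<le> q"
      unfolding q_def by (rule Max_ge) simp_all
    moreover have "\<bar>(y - x) \<bullet> b\<bar> \<le> q" if "b \<in> Basis" for b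
      unfolding q_def by (rule Max_ge) (use that in auto)
    ultimately show ?thesis
      using s_pos by (intro that[of "(q + s) / 2"]) (force simp: open_cube_iff)+
  qed
  define F' where "F' n z v = t ^ n *\<^sub>R frechet_derivative (b n) (at z) v" for n z v
  define M where "M n = N n * s ^ n * (real DIM('a) / (s - r))" for n
  have bd: "b n differentiable at z" if "z \<in> open_cube x r" for n z
    using has_mps_differentiable[OF mps r(2,1) open_cube_imp_cube[OF that]] by simp
  have le: "norm (F' n z v) \<le> M n * norm v" if z: "z \<in> open_cube x r" for n z v
  proof -
    interpret linear "frechet_derivative (b n) (at z)"
      using bd[OF z] by (rule linear_frechet_derivative)
    have "norm (frechet_derivative (b n) (at z) b') \<le> N n / (s - r)" if "b' \<in> Basis" for b'
      using has_mps_norm_le[OF has_mps_frechet_derivative[OF mps r(2,1) that] open_cube_imp_cube[OF z]] by simp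
    then have "norm (\<Sum>b'\<in>Basis. (v \<bullet> b') *\<^sub>R frechet_derivative (b n) (at z) b')
        \<le> (\<Sum>b'\<in>(Basis :: 'a set). norm v * (N n / (s - r)))"
      by (intro sum_norm_le) (auto simp: Basis_le_norm intro!: mult_mono simp del: times_divide_eq_right)
    moreover have "frechet_derivative (b n) (at z) v = (\<Sum>b'\<in>Basis. (v \<bullet> b') *\<^sub>R frechet_derivative (b n) (at z) b')"
      by (subst (1) euclidean_representation[of v, symmetric]) (simp add: sum scale)
    ultimately have fd: "norm (frechet_derivative (b n) (at z) v) \<le> real DIM('a) * (norm v * (N n / (s - r)))"
      by simp
    have "\<bar>t\<bar> ^ n * norm (frechet_derivative (b n) (at z) v) \<le> s ^ n * (real DIM('a) * (norm v * (N n / (s - r))))"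
      using s_pos by (intro mult_mono fd power_mono t) auto
    then show ?thesis
      by (simp add: F'_def M_def power_abs mult_ac)
  qed
  have Ms: "M summable_on UNIV"
    unfolding M_def by (rule summable_on_cmult_left[OF summable_weights])
  show der: "(val t has_derivative (\<lambda>v. \<Sum>\<^sub>\<infinity>n. t ^ n *\<^sub>R frechet_derivative (b n) (at y) v)) (at y)"
    unfolding F'_def[symmetric]
  proof (rule has_derivative_has_sum[where S="open_cube x r" and F="\<lambda>n z. t ^ n *\<^sub>R b n z" and M=M])
    fix n z v assume z: "z \<in> open_cube x r"
    show "((\<lambda>z. t ^ n *\<^sub>R b n z) has_derivative F' n z) (at z)"
      unfolding F'_def using bd[OF z] by (intro has_derivative_scaleR_right) (simp add: frechet_derivative_works)
    show "norm (F' n z v) \<le> M n * norm v"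
      by (rule le[OF z])
    show "((\<lambda>n. t ^ n *\<^sub>R b n z) has_sum val t z) UNIV"
      using open_cube_imp_cube[OF z] cube_mono[of r s] r by (intro has_sum_val t) auto
  next
    show "0 \<le> M n" for n
      unfolding M_def using r s_pos N_nonneg by simp
  qed (use Ms r in auto)
  show "((\<lambda>n. t ^ n *\<^sub>R frechet_derivative (b n) (at y) v) has_sum frechet_derivative (val t) (at y) v) UNIV" for v
    unfolding frechet_derivative_at[OF der, symmetric] F'_def[symmetric]
    by (rule has_sum_infsum, rule abs_summable_summable[OF Infinite_Sum.abs_summable_on_comparison_test'[OF summable_on_cmult_left[OF Ms]]],
        rule le[OF r(3)])
qed

end

text \<open>A real power series with a nonzero coefficient has no zeros close to but different from
  0; this is applied to each coordinate. Zeros that merely accumulate at 0 are what the continuation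
  argument supplies.\<close>

lemma powser_coeffs_zero:
  fixes d :: "nat \<Rightarrow> 'b::euclidean_space"
  assumes r: "0 < r" and f: "\<And>t. \<bar>t\<bar> < r \<Longrightarrow> ((\<lambda>n. t ^ n *\<^sub>R d n) has_sum f t) UNIV"
    and z: "\<exists>\<^sub>F t in at 0. f t = 0"
  shows "d n = 0"
proof (rule euclidean_eqI)
  fix b :: 'b assume "b \<in> Basis"
  define a where "a n = d n \<bullet> b" for n
  define g where "g t = f t \<bullet> b" for t
  have sm: "(\<lambda>n. a n * t ^ n) sums g t" if "norm t < r" for t
    using has_sum_imp_sums[OF has_sum_bounded_linear[OF bounded_linear_inner_left f, of t b]] that
    by (simp add: o_def a_def g_def mult.commute)
  have gz: "\<exists>\<^sub>F t in at 0. g t = 0"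
    using z by (rule frequently_elim1) (simp add: g_def)
  have lim: "(g \<longlongrightarrow> a 0) (at 0)"
    by (rule powser_limit_0[OF r sm])
  \<comment> \<open>\<open>powser_0_nonzero\<close> presupposes \<open>g 0 = 0\<close>, so the
    constant coefficient is settled first, by continuity.\<close>
  have a0: "a 0 = 0"
  proof (rule ccontr)
    assume "a 0 \<noteq> 0"
    then have "\<forall>\<^sub>F t in at 0. g t \<noteq> 0"
      using lim tendsto_imp_eventually_ne by blast
    then show False
      using gz by (simp add: frequently_def)
  qed
  have g0: "g 0 = 0"
    using sums_unique2[OF sm[of 0] powser_sums_zero] a0 r by simp
  have "a n = 0"
  proof (rule ccontr)
    assume an: "a n \<noteq> 0"
    then have "0 < n" using a0 by (cases n) auto
    obtain s where s: "0 < s" "\<And>z. z \<in> cball 0 s - {0} \<Longrightarrow> g z \<noteq> 0"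
      using powser_0_nonzero[of r 0 a g n] r sm g0 an \<open>0 < n\<close> by (metis diff_zero)
    then have "\<forall>\<^sub>F t in at 0. g t \<noteq> 0"
      unfolding eventually_at by (intro exI[of _ s]) auto
    then show False
      using gz by (simp add: frequently_def)
  qed
  then show "d n \<bullet> b = 0 \<bullet> b"
    by (simp add: a_def)
qed


section \<open>The Cauchy--Kovalevskaya estimate\<close>

lemma norm_cross3_le: "norm (cross3 x y) \<le> norm x * norm y"
proof (rule power2_le_imp_le)
  show "(norm (cross3 x y))\<^sup>2 \<le> (norm x * norm y)\<^sup>2"
    using norm_cross_dot[of x y] by (metis le_add_same_cancel1 zero_le_power2)
qed simp

lemma bounded_bilinear_cross3: "bounded_bilinear cross3"
  using bilinear_cross bilinear_conv_bounded_bilinear by blast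

lemma Basis_vec_range: "(Basis :: (real^'n) set) = range (\<lambda>i. axis i 1)"
  by (auto simp: Basis_vec_def)

text \<open>In this form the curl is a sum of bounded linear maps of the three directional
  derivatives, and can be estimated and applied term by term.\<close>

lemma curl_eq_sum: "curl f x = (\<Sum>b\<in>Basis. cross3 b (frechet_derivative f (at x) b))"
proof -
  have "(\<Sum>b\<in>Basis. cross3 b (frechet_derivative f (at x) b)) =
      (\<Sum>i\<in>UNIV. cross3 (axis i 1) (frechet_derivative f (at x) (axis i 1)))"
    unfolding Basis_vec_range by (subst sum.reindex) (auto simp: inj_on_def axis_eq_axis)
  then show ?thesis
    by (simp add: curl_def jacobian_def matrix_def Let_def sum_3 vec_eq_iff forall_3 cross3_def axis_def)
qed

text \<open>\<open>frechet_derivative\<close> is a choice from the predicate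
  \<open>has_derivative\<close>; that predicate is local, so both functions receive the same
  choice.\<close>

lemma curl_cong:
  assumes "open S" "x \<in> S" "\<And>y. y \<in> S \<Longrightarrow> f y = g y"
  shows "curl f x = curl g x"
proof -
  have "(f has_derivative D) (at x) \<longleftrightarrow> (g has_derivative D) (at x)" for D
    using has_derivative_transform_within_open[of f D x UNIV S g]
      has_derivative_transform_within_open[of g D x UNIV S f] assms by auto
  then show ?thesis
    by (simp add: curl_eq_sum frechet_derivative_def)
qed

lemma curl_translation_invariant:
  assumes "\<And>x. f (x + c) = f x"
  shows "curl f (x + c) = curl f x"
proof -
  have "f (x + c + h) = f (x + h)" for h
    using assms[of "x + h"] by (simp add: add_ac)
  then have "(f has_derivative D) (at (x + c)) \<longleftrightarrow> (f has_derivative D) (at x)" for D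
    by (simp add: has_derivative_at assms)
  then show ?thesis
    by (simp add: curl_eq_sum frechet_derivative_def)
qed

text \<open>The 3 counts the directions, each with the loss \<open>1 / (s - t)\<close>; a cross
  product with a unit vector does not increase norms.\<close>

lemma has_mps_curl:
  assumes f: "has_mps f x s N" and t: "0 < t" "t < s"
  shows "has_mps (curl f) x t (3 * (N / (s - t)))"
proof -
  have "has_mps (\<lambda>y. cross3 b (frechet_derivative f (at y) b)) x t (1 * (N / (s - t)))" if "b \<in> Basis" for b
    by (rule has_mps_bounded_linear[OF bounded_bilinear.bounded_linear_right[OF bounded_bilinear_cross3]
          _ _ has_mps_frechet_derivative[OF f t that]])
       (use norm_cross3_le[of b] that in \<open>auto simp: norm_Basis\<close>)
  then have "has_mps (\<lambda>y. \<Sum>b\<in>Basis. cross3 b (frechet_derivative f (at y) b)) x t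
      (\<Sum>b\<in>(Basis :: (real^3) set). 1 * (N / (s - t)))"
    by (intro has_mps_sum t(1)) auto
  then show ?thesis
    by (simp add: curl_eq_sum[abs_def])
qed

text \<open>Pairs of indices are grouped along the antidiagonals \<open>i + j = n\<close>. The
  absolute convergence behind this comes from finite dimension.\<close>

lemma has_sum_cauchy_product:
  fixes a :: "nat \<Rightarrow> 'a::euclidean_space" and b :: "nat \<Rightarrow> 'b::euclidean_space"
    and B :: "'a \<Rightarrow> 'b \<Rightarrow> 'c::banach"
  assumes B: "bounded_bilinear B"
    and F: "((\<lambda>n. t ^ n *\<^sub>R a n) has_sum F) UNIV" and G: "((\<lambda>n. t ^ n *\<^sub>R b n) has_sum G) UNIV"
  shows "((\<lambda>n. t ^ n *\<^sub>R (\<Sum>k\<le>n. B (a k) (b (n - k)))) has_sum B F G) UNIV"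
proof -
  interpret bounded_bilinear B by fact
  have "((\<lambda>(i, j). B (t ^ i *\<^sub>R a i) (t ^ j *\<^sub>R b j)) has_sum B F G) (UNIV \<times> UNIV)"
    by (intro has_sum_bilinear[OF B] summable_on_imp_norm_summable_on F G has_sum_imp_summable[OF F] has_sum_imp_summable[OF G])
  then show ?thesis
  proof (rule has_sum_fibers[where p="\<lambda>(i, j). i + j"])
    fix n :: nat
    have eq: "{z \<in> UNIV \<times> UNIV. (case z of (i, j) \<Rightarrow> i + j) = n} = (\<lambda>k. (k, n - k)) ` {..n}"
      by (auto simp: image_iff)
    show "((\<lambda>(i, j). B (t ^ i *\<^sub>R a i) (t ^ j *\<^sub>R b j)) has_sum t ^ n *\<^sub>R (\<Sum>k\<le>n. B (a k) (b (n - k))))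
        {z \<in> UNIV \<times> UNIV. (case z of (i, j) \<Rightarrow> i + j) = n}"
      unfolding eq
    proof (rule has_sum_finiteI)
      have "t ^ (n - k) *\<^sub>R t ^ k *\<^sub>R v = t ^ n *\<^sub>R v" if "k \<le> n" for k and v :: 'c
        using that by (simp add: power_add[symmetric])
      then show "t ^ n *\<^sub>R (\<Sum>k\<le>n. B (a k) (b (n - k))) =
          (\<Sum>(i, j)\<in>(\<lambda>k. (k, n - k)) ` {..n}. B (t ^ i *\<^sub>R a i) (t ^ j *\<^sub>R b j))"
        by (subst sum.reindex) (auto simp: inj_on_def scaleR_left scaleR_right scaleR_sum_right simp del: scaleR_scaleR)
    qed simp
  qed simp
qed

section \<open>The coefficient recursion and its majorant\<close>

fun time_coeff :: "(real^3 \<Rightarrow> real^3) \<Rightarrow> nat \<Rightarrow> real^3 \<Rightarrow> real^3" where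
  "time_coeff u0 0 = u0"
| "time_coeff u0 (Suc n) = (\<lambda>x. (- 1 / real (Suc n)) *\<^sub>R
     (\<Sum>k\<le>n. cross3 (curl (time_coeff u0 k) x) (time_coeff u0 (n - k) x)))"

declare time_coeff.simps(2) [simp del]

lemma torus_periodic_time_coeff:
  assumes "torus_periodic u0"
  shows "torus_periodic (time_coeff u0 n)"
proof (induction n rule: less_induct)
  case (less n)
  show ?case
  proof (cases n)
    case (Suc m)
    have "curl (time_coeff u0 k) (x + (2 * pi) *\<^sub>R axis i 1) = curl (time_coeff u0 k) x"
      "time_coeff u0 k (x + (2 * pi) *\<^sub>R axis i 1) = time_coeff u0 k x" if "k \<le> m" for k x i
      using less[of k] that Suc unfolding torus_periodic_def
      by (auto intro!: curl_translation_invariant)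
    then show ?thesis
      unfolding torus_periodic_def Suc time_coeff.simps by simp
  qed (use assms in simp)
qed

text \<open>A scaled Catalan recursion. The constant is \<open>18 = 3 * 6\<close>, with 3 from
  \<open>has_mps_curl\<close> and 6 from \<open>shrink_power_le\<close>.\<close>

fun majorant :: "real \<Rightarrow> nat \<Rightarrow> real" where
  "majorant N 0 = N"
| "majorant N (Suc n) = 18 * (\<Sum>k\<le>n. majorant N k * majorant N (n - k))"

declare majorant.simps(2) [simp del]

lemma majorant_nonneg: "0 \<le> N \<Longrightarrow> 0 \<le> majorant N n"
proof (induction n rule: less_induct)
  case (less n)
  then show ?case
    by (cases n) (auto simp: majorant.simps(2) intro!: sum_nonneg mult_nonneg_nonneg)
qed

text \<open>The partial sums of the generating function satisfy \<open>S (n + 1) \<le> N + 18 z (S n)\<^sup>2\<close>.\<close>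

lemma majorant_le:
  assumes "0 < N"
  shows "majorant N n \<le> 2 * N * (72 * N) ^ n"
proof -
  \<comment> \<open>\<open>72 = 4 * 18\<close> makes \<open>2 * N\<close> a fixed point of the
    quadratic bound: \<open>N + 18 * z * (2 * N) ^ 2 = 2 * N\<close>.\<close>
  define z where "z = 1 / (72 * N)"
  have z: "0 < z" "72 * z * N = 1" using assms by (auto simp: z_def)
  define m where "m k = majorant N k * z ^ k" for k
  have m_nn: "0 \<le> m k" for k
    unfolding m_def using assms z by (simp add: majorant_nonneg)
  have S: "(\<Sum>k\<le>n. m k) \<le> 2 * N" for n
  proof (induction n)
    case (Suc n)
    have nn: "0 \<le> (\<Sum>k\<le>n. m k)" by (intro sum_nonneg m_nn)
    have m_Suc: "m (Suc j) = 18 * z * (\<Sum>k\<le>j. m k * m (j - k))" for j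
    proof -
      have "majorant N k * majorant N (j - k) * z ^ j = m k * m (j - k)" if "k \<le> j" for k
        using that unfolding m_def by (simp add: mult_ac) (metis le_add_diff_inverse power_add)
      then have "(\<Sum>k\<le>j. majorant N k * majorant N (j - k)) * z ^ j = (\<Sum>k\<le>j. m k * m (j - k))"
        unfolding sum_distrib_right by (intro sum.cong) auto
      then show ?thesis
        by (simp add: m_def[of "Suc j"] majorant.simps(2))
    qed
    have "(\<Sum>k\<le>Suc n. m k) = m 0 + (\<Sum>j\<le>n. m (Suc j))"
      by (rule sum.atMost_Suc_shift)
    also have "m 0 = N" by (simp add: m_def)
    also have "(\<Sum>j\<le>n. m (Suc j)) = 18 * z * (\<Sum>j\<le>n. \<Sum>k\<le>j. m k * m (j - k))"
      by (simp add: m_Suc sum_distrib_left)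
    also have "(\<Sum>j\<le>n. \<Sum>k\<le>j. m k * m (j - k)) = (\<Sum>(i, j)\<in>{(i, j). i + j \<le> n}. m i * m j)"
      by (rule sum.triangle_reindex_eq[symmetric])
    \<comment> \<open>The triangle \<open>i + j \<le> n\<close> is enlarged to a square, on which
      the double sum is the square of the partial sum.\<close>
    also have "\<dots> \<le> (\<Sum>(i, j)\<in>{..n} \<times> {..n}. m i * m j)"
      by (rule sum_mono2) (auto intro!: mult_nonneg_nonneg m_nn)
    also have "\<dots> = (\<Sum>k\<le>n. m k) * (\<Sum>k\<le>n. m k)"
      by (simp add: sum_product sum.cartesian_product)
    also have "\<dots> \<le> (2 * N) * (2 * N)"
      using Suc nn assms by (intro mult_mono) auto
    also have "N + 18 * z * ((2 * N) * (2 * N)) = N + (72 * z * N) * N"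
      by (simp add: algebra_simps)
    finally show ?case
      using z by simp
  qed (use assms in \<open>simp add: m_def\<close>)
  have "m n \<le> (\<Sum>k\<le>n. m k)"
    by (rule member_le_sum) (auto simp: m_nn)
  then have "m n \<le> 2 * N"
    using S[of n] by linarith
  then show ?thesis
    using assms unfolding m_def z_def by (simp add: field_simps)
qed

text \<open>Here \<open>(1 + 1 / (k + 1)) ^ k \<le> exp 1 \<le> 3\<close> and
  \<open>k + 2 \<le> 2 * (k + 1)\<close>. Up to the factor \<open>3 * majorant N k\<close>, the left
  side is the cost of the curl of the \<open>k\<close>-th coefficient in
  \<open>has_mps_time_coeff\<close>.\<close>

lemma shrink_power_le:
  fixes d :: real
  assumes "0 < d"
  shows "(1 / (d * (real k + 1) / (real k + 2)) ^ k) / (d / (real k + 2)) \<le> 6 * (real k + 1) / d ^ Suc k"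
proof -
  have "((real k + 2) / (real k + 1)) ^ k = (1 + 1 / (real k + 1)) ^ k"
    by (simp add: field_simps)
  also have "\<dots> \<le> exp (1 / (real k + 1)) ^ k"
    by (intro power_mono exp_ge_add_one_self) auto
  also have "\<dots> = exp (real k / (real k + 1))"
    by (simp add: exp_of_nat_mult[symmetric])
  also have "\<dots> \<le> exp 1"
    by simp
  also have "\<dots> \<le> 3" by (rule exp_le)
  finally have "((real k + 2) / (real k + 1)) ^ k * (real k + 2) \<le> 3 * (2 * (real k + 1))"
    by (intro mult_mono) auto
  then have "((real k + 2) / (real k + 1)) ^ k * (real k + 2) / d ^ Suc k \<le> 3 * (2 * (real k + 1)) / d ^ Suc k"
    using assms by (intro divide_right_mono) auto
  then show ?thesis
    using assms by (simp add: power_divide power_mult_distrib mult_ac)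
qed

text \<open>
  To bound the curl of the \<open>k\<close>-th coefficient at radius \<open>s\<close>, the radius is enlarged by the fraction
  \<open>1 / (k + 2)\<close> of the remaining distance to \<open>s0\<close>; the loss is then only a factor of order \<open>k + 1\<close>, which
  the factor \<open>1 / (n + 1)\<close> from the integration in time absorbs.
\<close>

lemma has_mps_time_coeff:
  assumes u0: "has_mps u0 x s0 N" and s: "0 < s" "s < s0"
  shows "has_mps (time_coeff u0 n) x s (majorant N n / (s0 - s) ^ n)"
  using s
proof (induction n arbitrary: s rule: less_induct)
  case (less n)
  have N: "0 \<le> N"
    using u0 by (rule has_mps_nonneg)
  show ?case
  proof (cases n)
    case 0
    then show ?thesis
      using has_mps_mono[OF u0 less.prems(1) less_imp_le[OF less.prems(2)]] by simp
  next
    case (Suc p)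
    define d where "d = s0 - s"
    have d: "0 < d" using less.prems by (simp add: d_def)
    have term_bound: "has_mps (\<lambda>y. cross3 (curl (time_coeff u0 k) y) (time_coeff u0 (p - k) y)) x s
        (18 * (real p + 1) * (majorant N k * majorant N (p - k)) / d ^ n)" if k: "k \<le> p" for k
    proof -
      define s' where "s' = s + d / (real k + 2)"
      have d2: "0 < d / (real k + 2)" "d / (real k + 2) < d"
        using d mult_nonneg_nonneg[of d "real k"] by (simp_all add: divide_less_eq distrib_left add_pos_nonneg)
      have s': "s < s'" "s' < s0"
        using d2 unfolding s'_def d_def by linarith+
      have s'd: "s' - s = d / (real k + 2)" "s0 - s' = d * (real k + 1) / (real k + 2)"
        unfolding s'_def d_def by (auto simp: field_simps)
      have "has_mps (time_coeff u0 k) x s' (majorant N k / (s0 - s') ^ k)"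
        using less.prems s' k Suc by (intro less.IH) auto
      from has_mps_curl[OF this less.prems(1) s'(1)]
      have c: "has_mps (curl (time_coeff u0 k)) x s (3 * (majorant N k * ((1 / (s0 - s') ^ k) / (s' - s))))"
        by simp
      have "has_mps (curl (time_coeff u0 k)) x s (3 * (majorant N k * (6 * (real k + 1) / d ^ Suc k)))"
        by (rule has_mps_mono[OF c less.prems(1) order_refl], unfold s'd)
           (intro mult_left_mono shrink_power_le d majorant_nonneg N; simp)
      moreover have "has_mps (time_coeff u0 (p - k)) x s (majorant N (p - k) / (s0 - s) ^ (p - k))"
        using less.prems Suc by (intro less.IH) auto
      ultimately have prod: "has_mps (\<lambda>y. cross3 (curl (time_coeff u0 k) y) (time_coeff u0 (p - k) y)) x s
          (1 * (3 * (majorant N k * (6 * (real k + 1) / d ^ Suc k)) * (majorant N (p - k) / (s0 - s) ^ (p - k))))"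
        by (intro has_mps_bilinear[OF bounded_bilinear_cross3]) (auto simp: norm_cross3_le)
      have eq: "1 * (3 * (majorant N k * (6 * (real k + 1) / d ^ Suc k)) * (majorant N (p - k) / (s0 - s) ^ (p - k)))
          = 18 * (real k + 1) * (majorant N k * majorant N (p - k)) / d ^ n"
      proof -
        have "d ^ Suc k * d ^ (p - k) = d ^ n"
          using k Suc by (simp add: power_add[symmetric])
        then show ?thesis
          unfolding d_def[symmetric] by (simp add: mult_ac)
      qed
      \<comment> \<open>Raising \<open>k + 1\<close> to \<open>p + 1\<close> gives all summands a
        common factor, the one by which \<open>time_coeff\<close> divides.\<close>
      have "18 * (real k + 1) * (majorant N k * majorant N (p - k)) / d ^ n
          \<le> 18 * (real p + 1) * (majorant N k * majorant N (p - k)) / d ^ n"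
        using d k by (intro divide_right_mono mult_right_mono mult_left_mono mult_nonneg_nonneg majorant_nonneg N) auto
      then show ?thesis
        by (rule has_mps_mono[OF prod[unfolded eq] less.prems(1) order_refl])
    qed
    have "has_mps (\<lambda>y. \<Sum>k\<le>p. cross3 (curl (time_coeff u0 k) y) (time_coeff u0 (p - k) y)) x s
        (\<Sum>k\<le>p. 18 * (real p + 1) * (majorant N k * majorant N (p - k)) / d ^ n)"
      using less.prems(1) term_bound by (intro has_mps_sum) auto
    also have "(\<Sum>k\<le>p. 18 * (real p + 1) * (majorant N k * majorant N (p - k)) / d ^ n)
        = (real p + 1) * (majorant N n / d ^ n)"
      by (simp add: Suc majorant.simps(2) sum_distrib_left sum_divide_distrib ac_simps distrib_left distrib_right)
    finally have "has_mps (time_coeff u0 n) x s (1 / (real p + 1) * ((real p + 1) * (majorant N n / d ^ n)))"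
      unfolding Suc time_coeff.simps
      by (intro has_mps_bounded_linear[OF bounded_linear_scaleR_right]) (auto simp: add_ac)
    then show ?thesis
      by (simp add: d_def)
  qed
qed

text \<open>Half of \<open>s0\<close> is kept as distance to the boundary. As
  \<open>majorant\<close> grows at most like \<open>(72 * N) ^ n\<close>, the weights are dominated
  by a geometric series of ratio \<open>\<sigma> * (72 * N) / (s0 / 2) \<le> 1 / 2\<close>.\<close>

lemma time_series_time_coeff:
  assumes u0: "has_mps u0 x s0 N" and N: "0 < N" "0 < \<sigma>" "\<sigma> < s0 / 2" "\<sigma> * (72 * N) \<le> s0 / 4"
  shows "time_series (time_coeff u0) x \<sigma> (\<lambda>n. majorant N n / (s0 / 2) ^ n)"
proof
  have s0: "0 < s0" using N by simp
  show "has_mps (time_coeff u0 n) x \<sigma> (majorant N n / (s0 / 2) ^ n)" for n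
    using has_mps_mono[OF has_mps_time_coeff[OF u0, of "s0/2" n] N(2) less_imp_le[OF N(3)]] s0 by simp
  have "summable (\<lambda>n. 2 * N * (1 / 2) ^ n)"
    by (intro summable_mult summable_geometric) simp
  then have g: "(\<lambda>n. 2 * N * (1 / 2) ^ n) summable_on UNIV"
    by (rule summable_nonneg_imp_summable_on) (use N in simp)
  show "(\<lambda>n. majorant N n / (s0 / 2) ^ n * \<sigma> ^ n) summable_on UNIV"
  proof (rule summable_on_comparison_test[OF g])
    fix n
    have "majorant N n / (s0 / 2) ^ n * \<sigma> ^ n \<le> 2 * N * (72 * N) ^ n / (s0 / 2) ^ n * \<sigma> ^ n"
      using N s0 by (intro mult_right_mono divide_right_mono majorant_le) auto
    also have "\<dots> = 2 * N * (\<sigma> * (72 * N) / (s0 / 2)) ^ n"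
      unfolding power_divide[of "\<sigma> * (72 * N)"] power_mult_distrib[of \<sigma>] by simp
    also have "\<dots> \<le> 2 * N * (1 / 2) ^ n"
      using N s0 by (intro mult_left_mono power_mono) (auto simp: field_simps)
    finally show "majorant N n / (s0 / 2) ^ n * \<sigma> ^ n \<le> 2 * N * (1 / 2) ^ n" .
    show "0 \<le> majorant N n / (s0 / 2) ^ n * \<sigma> ^ n"
      using N s0 by (simp add: majorant_nonneg)
  qed
qed


section \<open>Existence and uniqueness\<close>

lemma torus_periodic_shift:
  assumes "torus_periodic f"
  shows "f (x + (2 * pi * of_int k) *\<^sub>R axis i 1) = f x"
proof -
  have step: "f (y + (2 * pi) *\<^sub>R axis i 1) = f y" for y
    using assms by (simp add: torus_periodic_def)
  have nat: "f (y + (2 * pi * real n) *\<^sub>R axis i 1) = f y" for n y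
  proof (induction n)
    case (Suc n)
    have "y + (2 * pi * real (Suc n)) *\<^sub>R axis i 1 = (y + (2 * pi * real n) *\<^sub>R axis i 1) + (2 * pi) *\<^sub>R axis i 1"
      by (simp add: algebra_simps)
    then show ?case
      using step Suc by metis
  qed simp
  show ?thesis
  proof (cases "0 \<le> k")
    case True
    then show ?thesis
      using nat[of x "nat k"] by simp
  next
    case False
    then show ?thesis
      using nat[of "x + (2 * pi * of_int k) *\<^sub>R axis i 1" "nat (- k)"] by simp
  qed
qed

lemma torus_periodic_shift_sum:
  assumes "torus_periodic f" "finite I"
  shows "f (x + (\<Sum>i\<in>I. (2 * pi * of_int (k i)) *\<^sub>R axis i 1)) = f x"
  using assms(2)
proof (induction arbitrary: x)
  case (insert i I)
  have "f (x + (2 * pi * of_int (k i)) *\<^sub>R axis i 1 + (\<Sum>i\<in>I. (2 * pi * of_int (k i)) *\<^sub>R axis i 1))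
      = f x"
    using insert.IH torus_periodic_shift[OF assms(1)] by metis
  then show ?case
    using insert.hyps by (simp add: add.assoc)
qed simp

text \<open>Whole periods are removed in each coordinate by a floor. With the increment
  \<open>h\<close> in the conclusion, an entire expansion at \<open>y\<close> carries over to
  \<open>x\<close> by \<open>has_mps_cong\<close>.\<close>

lemma fundamental_cell_representative:
  fixes x :: "real^3"
  obtains y where "y \<in> cbox 0 (\<chi> i. 2 * pi)"
    "\<And>f :: real^3 \<Rightarrow> 'b. torus_periodic f \<Longrightarrow> (\<forall>h. f (y + h) = f (x + h))"
proof -
  define k where "k i = - \<lfloor>x $ i / (2 * pi)\<rfloor>" for i
  define z where "z = (\<Sum>i\<in>UNIV. (2 * pi * of_int (k i)) *\<^sub>R axis i (1 :: real) :: real^3)"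
  have z: "z $ i = 2 * pi * of_int (k i)" for i
    unfolding z_def by (simp add: axis_def if_distrib cong: if_cong)
  have "0 \<le> (x + z) $ i \<and> (x + z) $ i \<le> 2 * pi" for i
  proof -
    define q where "q = x $ i / (2 * pi)"
    have "x $ i = 2 * pi * q" by (simp add: q_def)
    then have "(x + z) $ i = 2 * pi * (q - of_int \<lfloor>q\<rfloor>)"
      by (simp add: z k_def q_def[symmetric] algebra_simps)
    moreover have "0 \<le> q - of_int \<lfloor>q\<rfloor>" "q - of_int \<lfloor>q\<rfloor> \<le> 1"
      by linarith+
    ultimately show ?thesis
      using mult_left_mono[of "q - of_int \<lfloor>q\<rfloor>" 1 "2 * pi"] by simp
  qed
  then have "x + z \<in> cbox 0 (\<chi> i. 2 * pi)"
    by (simp add: mem_box_cart)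
  moreover have "f (x + z + h) = f (x + h)" if "torus_periodic f" for f :: "real^3 \<Rightarrow> 'b" and h
    using torus_periodic_shift_sum[OF that, of UNIV "x + h" k] by (simp add: z_def add_ac)
  ultimately show ?thesis
    using that by blast
qed

text \<open>Compactness of a period cell. Each radius is split as \<open>r + r\<close>: one half
  reaches the points of the covering cube, the other remains as radius there with the same bound. A
  minimum and a maximum over a finite subcover then serve everywhere.\<close>

lemma uniform_has_mps:
  fixes u0 :: "real^3 \<Rightarrow> real^3"
  assumes per: "torus_periodic u0" and an: "\<And>x. real_analytic_at u0 x"
  obtains s N where "0 < s" "0 < N" "\<And>x. has_mps u0 x s N"
proof -
  have "\<exists>r M. has_mps u0 x (r + r) M" for x
  proof -
    obtain s M where "has_mps u0 x s M"
      using an real_analytic_at_imp_has_mps by blast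
    then have "has_mps u0 x (s/2 + s/2) M" by simp
    then show ?thesis by blast
  qed
  then obtain r M where rM: "\<And>x. has_mps u0 x (r x + r x) (M x)"
    by metis
  have r: "0 < r x" for x
    using has_mps_pos[OF rM[of x]] by simp
  have cover: "cbox 0 (\<chi> i. 2 * pi) \<subseteq> (\<Union>x\<in>UNIV. open_cube x (r x))"
    using r by (meson UNIV_I UN_I open_cube_center subsetI)
  obtain C where C: "finite C" "cbox 0 (\<chi> i. 2 * pi) \<subseteq> (\<Union>x\<in>C. open_cube x (r x))"
    by (rule compactE_image[OF compact_cbox _ cover]) auto
  have "(0 :: real^3) \<in> cbox 0 (\<chi> i. 2 * pi)"
    by (simp add: mem_box_cart)
  then have "C \<noteq> {}"
    using C by auto
  define s where "s = Min (r ` C)"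
  \<comment> \<open>The \<open>1\<close> makes \<open>N\<close> positive even if all bounds vanish;
    later constants divide by \<open>N\<close>.\<close>
  define N where "N = Max (insert 1 (M ` C))"
  have s: "0 < s"
    unfolding s_def using C \<open>C \<noteq> {}\<close> r by (subst Min_gr_iff) auto
  have "1 \<le> N"
    unfolding N_def using C by (intro Max_ge) auto
  moreover have "has_mps u0 x s N" for x
  proof -
    obtain y where y: "y \<in> cbox 0 (\<chi> i. 2 * pi)" "\<And>h. u0 (y + h) = u0 (x + h)"
      using fundamental_cell_representative[where 'b="real^3", of x] per by metis
    obtain c where c: "c \<in> C" "y \<in> open_cube c (r c)"
      using C y by auto
    have "has_mps u0 (c + (y - c)) (r c) (M c)"
      by (rule has_mps_recenter[OF rM open_cube_imp_cube[OF c(2)] r])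
    moreover have "s \<le> r c" "M c \<le> N"
      unfolding s_def N_def using C c by (auto intro: Min_le Max_ge)
    ultimately have "has_mps u0 y s N"
      using has_mps_mono[of u0 y "r c" "M c" s N] s by simp
    then show ?thesis
      by (rule has_mps_cong) (use y in simp)
  qed
  ultimately show ?thesis
    using that[of s N] s by simp
qed

text \<open>Formal coefficient of \<open>t ^ n\<close> in the left-hand side of the equation, for
  the series in time with coefficients \<open>b\<close>.\<close>

definition residual :: "(nat \<Rightarrow> real^3 \<Rightarrow> real^3) \<Rightarrow> nat \<Rightarrow> real^3 \<Rightarrow> real^3" where
  "residual b n y = real (Suc n) *\<^sub>R b (Suc n) y + (\<Sum>k\<le>n. cross3 (curl (b k) y) (b (n - k) y))"

lemma residual_time_coeff: "residual (time_coeff u0) n y = 0"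
  by (simp add: residual_def time_coeff.simps(2))

text \<open>A vanishing residual determines \<open>b (Suc n)\<close> from the earlier coefficients.
  The induction runs over all of the open \<open>S\<close> at once, because a curl at a point
  depends on nearby values.\<close>

lemma residual_zero_imp_eq_time_coeff:
  assumes S: "open S" and b0: "\<And>y. y \<in> S \<Longrightarrow> b 0 y = u0 y"
    and res: "\<And>n y. y \<in> S \<Longrightarrow> residual b n y = 0" and y: "y \<in> S"
  shows "b n y = time_coeff u0 n y"
  using y
proof (induction n arbitrary: y rule: less_induct)
  case (less n)
  show ?case
  proof (cases n)
    case (Suc p)
    have "b k y = time_coeff u0 k y" "curl (b k) y = curl (time_coeff u0 k) y" if "k \<le> p" for k
      using less that Suc by (auto intro!: curl_cong[OF S])
    then have "(\<Sum>k\<le>p. cross3 (curl (b k) y) (b (p - k) y)) =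
        (\<Sum>k\<le>p. cross3 (curl (time_coeff u0 k) y) (time_coeff u0 (p - k) y))"
      by (intro sum.cong) auto
    then have "real (Suc p) *\<^sub>R b (Suc p) y = real (Suc p) *\<^sub>R time_coeff u0 (Suc p) y"
      using res[OF less.prems, of p] residual_time_coeff[of u0 p y]
      by (simp only: residual_def eq_neg_iff_add_eq_0[symmetric])
    then show ?thesis
      by (simp add: Suc)
  qed (use b0 less in simp)
qed

lemma has_sum_finite_sum:
  fixes f :: "'j \<Rightarrow> 'i \<Rightarrow> 'b::real_normed_vector"
  assumes "finite J" "\<And>j. j \<in> J \<Longrightarrow> (f j has_sum a j) A"
  shows "((\<lambda>i. \<Sum>j\<in>J. f j i) has_sum (\<Sum>j\<in>J. a j)) A"
  using assms by induction (auto intro: has_sum_add)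

text \<open>Time derivative, curl and product are all taken term by term. Existence reads the result
  from residuals to the equation, uniqueness in the opposite direction.\<close>

lemma has_sum_residual:
  assumes ts: "time_series b x s N" and t: "\<bar>t\<bar> < s" and y: "y \<in> open_cube x s"
  obtains D where "((\<lambda>t. time_series.val b t y) has_vector_derivative D) (at t)"
    "((\<lambda>n. t ^ n *\<^sub>R residual b n y) has_sum
      D + cross3 (curl (time_series.val b t) y) (time_series.val b t y)) UNIV"
proof -
  interpret time_series b x s N by fact
  have yc: "y - x \<in> cube s"
    using y by (rule open_cube_imp_cube)
  obtain D where D: "((\<lambda>t. val t y) has_vector_derivative D) (at t)"
    "((\<lambda>n. t ^ n *\<^sub>R (real (Suc n) *\<^sub>R b (Suc n) y)) has_sum D) UNIV"
    using has_vector_derivative_val[OF t yc] by blast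
  have "((\<lambda>n. \<Sum>e\<in>Basis. cross3 e (t ^ n *\<^sub>R frechet_derivative (b n) (at y) e)) has_sum
      (\<Sum>e\<in>Basis. cross3 e (frechet_derivative (val t) (at y) e))) UNIV"
    using has_sum_bounded_linear[OF bounded_bilinear.bounded_linear_right[OF bounded_bilinear_cross3]
        has_derivative_val(2)[OF less_imp_le[OF t] y]]
    by (intro has_sum_finite_sum) (simp_all add: o_def)
  then have "((\<lambda>n. t ^ n *\<^sub>R curl (b n) y) has_sum curl (val t) y) UNIV"
    by (simp add: curl_eq_sum cross_mult_right scaleR_sum_right)
  from has_sum_add[OF D(2) has_sum_cauchy_product[OF bounded_bilinear_cross3 this has_sum_val[OF less_imp_le[OF t] yc]]]
  have "((\<lambda>n. t ^ n *\<^sub>R residual b n y) has_sum D + cross3 (curl (val t) y) (val t y)) UNIV"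
    by (simp add: residual_def scaleR_add_right)
  then show ?thesis
    using D(1) that by blast
qed

text \<open>Near each point of the interval the expansion makes \<open>\<phi>\<close> either
  identically zero or free of zeros apart from the point itself. The corresponding sets
  \<open>A\<close> and \<open>B\<close> are open and disjoint, so by connectedness the interval lies
  in one of them, and \<open>c\<close> belongs to \<open>A\<close>.\<close>

lemma analytic_zero_on_interval:
  fixes \<phi> :: "real \<Rightarrow> 'b::euclidean_space"
  assumes an: "\<And>t. t \<in> {a..b} \<Longrightarrow> \<exists>r>0. \<exists>d. \<forall>\<tau>. \<bar>\<tau>\<bar> < r \<longrightarrow> ((\<lambda>n. \<tau> ^ n *\<^sub>R d n) has_sum \<phi> (t + \<tau>)) UNIV"
    and z: "c \<in> {a..b}" "\<forall>\<^sub>F t in nhds c. \<phi> t = 0" and t: "t \<in> {a..b}"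
  shows "\<phi> t = 0"
proof -
  define A where "A = {t. \<forall>\<^sub>F \<tau> in nhds t. \<phi> \<tau> = 0}"
  define B where "B = {t. \<forall>\<^sub>F \<tau> in at t. \<phi> \<tau> \<noteq> 0}"
  have dichotomy: "t \<in> A \<or> t \<in> B" if "t \<in> {a..b}" for t
  proof (rule disjCI)
    assume "t \<notin> B"
    then have fr: "\<exists>\<^sub>F \<tau> in at 0. \<phi> (t + \<tau>) = 0"
      unfolding B_def frequently_def by (subst (asm) at_to_0) (simp add: eventually_filtermap add.commute)
    obtain r d where r: "0 < r" "\<And>\<tau>. \<bar>\<tau>\<bar> < r \<Longrightarrow> ((\<lambda>n. \<tau> ^ n *\<^sub>R d n) has_sum \<phi> (t + \<tau>)) UNIV"
      using an[OF \<open>t \<in> {a..b}\<close>] by blast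
    have "d n = 0" for n
      by (rule powser_coeffs_zero[OF r fr])
    then have "\<phi> (t + \<tau>) = 0" if "\<bar>\<tau>\<bar> < r" for \<tau>
      using has_sum_unique[OF r(2)[OF that]] by simp
    from this[of "_ - t"] show "t \<in> A"
      unfolding A_def mem_Collect_eq eventually_nhds_metric dist_real_def
      using r(1) by (intro exI[of _ r]) auto
  qed
  have "open A"
    unfolding A_def eventually_nhds by (subst open_subopen) blast
  moreover have "open B"
  proof (subst open_subopen, intro ballI)
    fix t assume "t \<in> B"
    then obtain S where S: "open S" "t \<in> S" "\<And>\<tau>. \<tau> \<in> S \<Longrightarrow> \<tau> \<noteq> t \<Longrightarrow> \<phi> \<tau> \<noteq> 0"
      unfolding B_def by (auto simp: eventually_at_topological)
    \<comment> \<open>A point of \<open>S\<close> other than \<open>t\<close> has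
      \<open>S - {t}\<close> as a neighbourhood without zeros.\<close>
    have "S \<subseteq> B"
    proof
      fix q assume q: "q \<in> S"
      show "q \<in> B"
      proof (cases "q = t")
        case False
        then show ?thesis
          unfolding B_def mem_Collect_eq eventually_at_topological
          using S q by (intro exI[of _ "S - {t}"]) auto
      qed (use \<open>t \<in> B\<close> in simp)
    qed
    then show "\<exists>T. open T \<and> t \<in> T \<and> T \<subseteq> B"
      using S by blast
  qed
  moreover have "A \<inter> B = {}"
  proof (rule ccontr)
    assume "A \<inter> B \<noteq> {}"
    then obtain q where "\<forall>\<^sub>F \<tau> in at q. \<phi> \<tau> = 0" "\<forall>\<^sub>F \<tau> in at q. \<phi> \<tau> \<noteq> 0"
      by (auto simp: A_def B_def eventually_nhds_conv_at)
    then have "\<forall>\<^sub>F \<tau> in at q. False"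
      by eventually_elim simp
    then show False by simp
  qed
  moreover have "{a..b} \<subseteq> A \<union> B"
    using dichotomy by blast
  ultimately have "A \<inter> {a..b} = {} \<or> B \<inter> {a..b} = {}"
    using connectedD[OF connected_Icc, of A B a b] by auto
  moreover have "c \<in> A"
    using z by (simp add: A_def)
  ultimately have "t \<in> A"
    using dichotomy t z(1) by blast
  then show ?thesis
    unfolding A_def by (auto dest: eventually_nhds_x_imp_x)
qed

section \<open>Comparison of analytic solutions\<close>

lemma real_analytic_at_line:
  fixes g :: "real \<times> 'a::euclidean_space \<Rightarrow> 'b::euclidean_space"
  assumes "real_analytic_at g (t, x)"
  shows "\<exists>r>0. \<exists>d. \<forall>\<tau>. \<bar>\<tau>\<bar> < r \<longrightarrow> ((\<lambda>n. \<tau> ^ n *\<^sub>R d n) has_sum g (t + \<tau>, x)) UNIV"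
proof -
  obtain s N where g: "has_mps g (t, x) s N"
    using assms by (rule real_analytic_at_imp_has_mps)
  then obtain b where b: "\<And>t' h. \<bar>t'\<bar> \<le> s \<Longrightarrow> h \<in> cube s \<Longrightarrow>
      ((\<lambda>n. t' ^ n *\<^sub>R b n (x + h)) has_sum g (t + t', x + h)) UNIV"
    by (rule has_mps_time_slices) blast
  show ?thesis
    using b[of _ 0] has_mps_pos[OF g] by (intro exI[of _ s] conjI exI[of _ "\<lambda>n. b n x"]) auto
qed

text \<open>The extension has two-sided expansions in time even at \<open>t = \<plusminus>T\<close>;
  the identity theorem along a line uses them at every point of the closed interval.\<close>

lemma analytic_solution_extension:
  assumes "analytic_solution u0 T u"
  obtains g where "\<And>t x. t \<in> {-T..T} \<Longrightarrow> real_analytic_at g (t, x)"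
    "\<And>t x. t \<in> {-T..T} \<Longrightarrow> g (t, x) = u t x"
proof -
  have "real_analytic_on (\<lambda>(t, x). u t x) ({-T..T} \<times> UNIV)"
    using assms unfolding analytic_solution_def by blast
  then obtain U g where g: "{-T..T} \<times> UNIV \<subseteq> U" "\<And>z. z \<in> U \<Longrightarrow> real_analytic_at g z"
    "\<And>z. z \<in> {-T..T} \<times> UNIV \<Longrightarrow> g z = (case z of (t, x) \<Rightarrow> u t x)"
    unfolding real_analytic_on_def by blast
  show ?thesis
  proof (rule that[of g])
    fix t and x :: "real^3" assume "t \<in> {-T..T}"
    then have "(t, x) \<in> {-T..T} \<times> UNIV" by simp
    then show "real_analytic_at g (t, x)" "g (t, x) = u t x"
      using g by (blast, auto)
  qed
qed

text \<open>The extension is sliced in time at \<open>(0, x)\<close>. The equation makes the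
  residuals of the slices vanish on a whole cube around \<open>x\<close>, which identifies them with
  \<open>time_coeff\<close>.\<close>

lemma analytic_solution_agrees_near_0:
  assumes T: "0 < T" and sol: "analytic_solution u0 T v"
  shows "\<exists>d>0. \<forall>t. \<bar>t\<bar> < d \<longrightarrow> v t x = (\<Sum>\<^sub>\<infinity>n. t ^ n *\<^sub>R time_coeff u0 n x)"
proof -
  obtain g where g: "\<And>t y. t \<in> {-T..T} \<Longrightarrow> real_analytic_at g (t, y)"
    "\<And>t y. t \<in> {-T..T} \<Longrightarrow> g (t, y) = v t y"
    using sol by (rule analytic_solution_extension) blast
  have "real_analytic_at g (0, x)"
    using g T by auto
  then obtain s N where sN: "has_mps g (0, x) s N"
    by (rule real_analytic_at_imp_has_mps)
  obtain b M where b: "\<And>n. has_mps (b n) x s (M n)" "(\<lambda>n. M n * s ^ n) summable_on UNIV"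
    "\<And>t h. \<bar>t\<bar> \<le> s \<Longrightarrow> h \<in> cube s \<Longrightarrow> ((\<lambda>n. t ^ n *\<^sub>R b n (x + h)) has_sum g (0 + t, x + h)) UNIV"
    by (rule has_mps_time_slices[OF sN]) (rule that)
  interpret time_series b x s M
    by standard (fact b)+
  let ?S = "open_cube x s"
  \<comment> \<open>\<open>s\<close> keeps the series convergent, \<open>T\<close> keeps the
    equation available.\<close>
  define d where "d = min s T"
  have d: "0 < d" "d \<le> s" "d \<le> T"
    using s_pos T by (auto simp: d_def)
  have val: "val t y = v t y" if "\<bar>t\<bar> < d" "y \<in> ?S" for t y
  proof -
    have t: "\<bar>t\<bar> \<le> s" "t \<in> {-T..T}"
      using that d by auto
    have "((\<lambda>n. t ^ n *\<^sub>R b n y) has_sum v t y) UNIV"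
      using b(3)[OF t(1) open_cube_imp_cube[OF that(2)]] g(2)[OF t(2)] by simp
    then show ?thesis
      using has_sum_unique[OF has_sum_val[OF t(1) open_cube_imp_cube[OF that(2)]]] by blast
  qed
  have res: "residual b n y = 0" if y: "y \<in> ?S" for n y
  proof (rule powser_coeffs_zero[where r=d and f="\<lambda>_. 0"])
    fix t assume t: "\<bar>t\<bar> < d"
    then have "\<bar>t\<bar> < s" using d by simp
    then obtain D where D: "((\<lambda>t. val t y) has_vector_derivative D) (at t)"
      "((\<lambda>n. t ^ n *\<^sub>R residual b n y) has_sum D + cross3 (curl (val t) y) (val t y)) UNIV"
      using has_sum_residual[OF time_series_axioms _ y] by blast
    have "((\<lambda>t. v t y) has_vector_derivative D) (at t)"
      by (rule has_vector_derivative_transform_within_open[OF D(1), of "{-d<..<d}"])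
         (use t val y in auto)
    then have "vector_derivative (\<lambda>s. v s y) (at t within {-T..T}) = D"
      using t d T by (intro vector_derivative_at_within_ivl) auto
    moreover have "curl (val t) y = curl (v t) y"
      by (rule curl_cong[of ?S]) (use val t y in auto)
    moreover have "t \<in> {-T..T}"
      using t d by auto
    then have "vector_derivative (\<lambda>s. v s y) (at t within {-T..T}) + cross3 (curl (v t) y) (v t y) = 0"
      using sol unfolding analytic_solution_def by blast
    ultimately show "((\<lambda>n. t ^ n *\<^sub>R residual b n y) has_sum 0) UNIV"
      using D(2) val[OF t y] by simp
  qed (use d in auto)
  have b0: "b 0 y = u0 y" if "y \<in> ?S" for y
  proof -
    have "((\<lambda>n. 0 ^ n *\<^sub>R b n y) has_sum b 0 y) UNIV"
      by (rule has_sum_finite_neutralI[of "{0}"]) auto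
    then have "val 0 y = b 0 y"
      unfolding val_def by (rule infsumI)
    then show ?thesis
      using val[of 0 y] that d sol unfolding analytic_solution_def by simp
  qed
  have "b n x = time_coeff u0 n x" for n
    by (rule residual_zero_imp_eq_time_coeff[of ?S]) (use b0 res s_pos in auto)
  then have "v t x = (\<Sum>\<^sub>\<infinity>n. t ^ n *\<^sub>R time_coeff u0 n x)" if "\<bar>t\<bar> < d" for t
    using val[OF that, of x] s_pos unfolding val_def by simp
  then show ?thesis
    using d by blast
qed

text \<open>Near \<open>t = 0\<close> both solutions equal the same series, and the difference of
  their extensions has an expansion at every time of the interval, so its zeros near 0 spread to all
  of it.\<close>

lemma analytic_solution_unique:
  assumes T: "0 < T" and u: "analytic_solution u0 T u" and v: "analytic_solution u0 T v"
    and t: "t \<in> {-T..T}"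
  shows "v t x = u t x"
proof -
  obtain g where g: "\<And>t x. t \<in> {-T..T} \<Longrightarrow> real_analytic_at g (t, x)"
    "\<And>t x. t \<in> {-T..T} \<Longrightarrow> g (t, x) = u t x"
    using u by (rule analytic_solution_extension) blast
  obtain h where h: "\<And>t x. t \<in> {-T..T} \<Longrightarrow> real_analytic_at h (t, x)"
    "\<And>t x. t \<in> {-T..T} \<Longrightarrow> h (t, x) = v t x"
    using v by (rule analytic_solution_extension) blast
  obtain d d' where d: "0 < d" "\<And>t. \<bar>t\<bar> < d \<Longrightarrow> u t x = (\<Sum>\<^sub>\<infinity>n. t ^ n *\<^sub>R time_coeff u0 n x)"
    and d': "0 < d'" "\<And>t. \<bar>t\<bar> < d' \<Longrightarrow> v t x = (\<Sum>\<^sub>\<infinity>n. t ^ n *\<^sub>R time_coeff u0 n x)"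
    using analytic_solution_agrees_near_0[OF T u, of x] analytic_solution_agrees_near_0[OF T v, of x] by blast
  have "h (t, x) - g (t, x) = 0"
  proof (rule analytic_zero_on_interval[where \<phi>="\<lambda>t. h (t, x) - g (t, x)" and c=0, OF _ _ _ t])
    fix t assume t: "t \<in> {-T..T}"
    obtain r a where r: "0 < r" "\<And>\<tau>. \<bar>\<tau>\<bar> < r \<Longrightarrow> ((\<lambda>n. \<tau> ^ n *\<^sub>R a n) has_sum g (t + \<tau>, x)) UNIV"
      using real_analytic_at_line[OF g(1)[OF t]] by blast
    obtain r' a' where r': "0 < r'" "\<And>\<tau>. \<bar>\<tau>\<bar> < r' \<Longrightarrow> ((\<lambda>n. \<tau> ^ n *\<^sub>R a' n) has_sum h (t + \<tau>, x)) UNIV"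
      using real_analytic_at_line[OF h(1)[OF t]] by blast
    have "((\<lambda>n. \<tau> ^ n *\<^sub>R (a' n - a n)) has_sum h (t + \<tau>, x) - g (t + \<tau>, x)) UNIV"
      if "\<bar>\<tau>\<bar> < min r r'" for \<tau>
      unfolding scaleR_diff_right by (intro has_sum_difference r r') (use that in auto)
    then show "\<exists>r>0. \<exists>d. \<forall>\<tau>. \<bar>\<tau>\<bar> < r \<longrightarrow> ((\<lambda>n. \<tau> ^ n *\<^sub>R d n) has_sum h (t + \<tau>, x) - g (t + \<tau>, x)) UNIV"
      using r(1) r'(1) by (intro exI[of _ "min r r'"] conjI exI[of _ "\<lambda>n. a' n - a n"]) auto
  next
    have "h (\<tau>, x) - g (\<tau>, x) = 0" if "\<bar>\<tau>\<bar> < min T (min d d')" for \<tau>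
    proof -
      have "\<tau> \<in> {-T..T}" "\<bar>\<tau>\<bar> < d" "\<bar>\<tau>\<bar> < d'"
        using that by auto
      then show ?thesis
        by (simp only: g(2) h(2) d(2) d'(2) diff_self)
    qed
    then show "\<forall>\<^sub>F t in nhds 0. h (t, x) - g (t, x) = 0"
      unfolding eventually_nhds_metric
      using T d(1) d'(1) by (intro exI[of _ "min T (min d d')"]) (auto simp: dist_real_def)
  qed (use T in simp)
  then show ?thesis
    using g(2) h(2) t by simp
qed

theorem theorem6p1:
  fixes u0 :: "real^3 \<Rightarrow> real^3"
  assumes "torus_periodic u0"
    and "real_analytic_on u0 UNIV"
  shows "\<exists>T>0. \<exists>u. analytic_solution u0 T u \<and>
           (\<forall>v. analytic_solution u0 T v \<longrightarrow> (\<forall>t\<in>{-T..T}. \<forall>x. v t x = u t x))"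
proof -
  have "real_analytic_at u0 x" for x
  proof -
    obtain g where "\<forall>x. real_analytic_at g x" "\<forall>x. g x = u0 x"
      using assms(2) unfolding real_analytic_on_def by auto
    then show ?thesis
      by (metis ext)
  qed
  then obtain s0 N where s0: "0 < s0" and N: "0 < N" and u0: "\<And>x. has_mps u0 x s0 N"
    using uniform_has_mps[OF assms(1)] by blast
  \<comment> \<open>\<open>288 = 4 * 72\<close> yields
    \<open>\<sigma> * (72 * N) \<le> s0 / 4\<close>; the bound \<open>s0 / 4\<close> keeps
    \<open>\<sigma>\<close> strictly below \<open>s0 / 2\<close>.\<close>
  define \<sigma> where "\<sigma> = min (s0 / 4) (s0 / (288 * N))"
  have \<sigma>: "0 < \<sigma>" "\<sigma> < s0 / 2"
    using s0 N by (auto simp: \<sigma>_def)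
  have "\<sigma> * (72 * N) \<le> s0 / (288 * N) * (72 * N)"
    unfolding \<sigma>_def using N by (intro mult_right_mono) auto
  then have \<sigma>': "\<sigma> * (72 * N) \<le> s0 / 4"
    using N by simp
  have ts: "time_series (time_coeff u0) x \<sigma> (\<lambda>n. majorant N n / (s0 / 2) ^ n)" for x
    by (rule time_series_time_coeff[OF u0 N \<sigma> \<sigma>'])
  define u where "u = time_series.val (time_coeff u0)"
  have u_eq: "u t x = (\<Sum>\<^sub>\<infinity>n. t ^ n *\<^sub>R time_coeff u0 n x)" for t x
    unfolding u_def by (rule time_series.val_def[OF ts])
  \<comment> \<open>Any positive \<open>T < \<sigma> / 2\<close> would do: the joint series at
    \<open>(0, x)\<close> has radius \<open>\<sigma>\<close>, of which one half is spent on moving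
    to \<open>(t, x)\<close> and the other remains as radius there.\<close>
  define T where "T = \<sigma> / 4"
  have T: "0 < T" "T < \<sigma> / 2" "T < \<sigma>"
    using \<sigma> by (auto simp: T_def)
  have "analytic_solution u0 T u"
    unfolding analytic_solution_def
  proof (intro conjI ballI allI)
    show "torus_periodic (u t)" for t
      using torus_periodic_time_coeff[OF assms(1)] by (simp add: torus_periodic_def u_eq)
    show "real_analytic_on (\<lambda>(t, x). u t x) ({-T..T} \<times> UNIV)"
      unfolding real_analytic_on_def
    proof (intro exI conjI ballI)
      show "open ({-\<sigma>/2<..<\<sigma>/2} \<times> (UNIV :: (real^3) set))"
        by (intro open_Times) auto
      show "{-T..T} \<times> UNIV \<subseteq> {-\<sigma>/2<..<\<sigma>/2} \<times> (UNIV :: (real^3) set)"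
        using T by auto
      fix z :: "real \<times> (real^3)" assume z: "z \<in> {-\<sigma>/2<..<\<sigma>/2} \<times> UNIV"
      obtain t x where tx: "z = (t, x)" by (cases z)
      have "has_mps (\<lambda>(t, x). u t x) (0, x) (\<sigma>/2 + \<sigma>/2) (\<Sum>\<^sub>\<infinity>n. majorant N n / (s0 / 2) ^ n * \<sigma> ^ n)"
        using time_series.has_mps_val[OF ts] by (simp add: u_def)
      moreover have "(t, 0) \<in> cube (\<sigma>/2)"
        using z \<sigma> by (auto simp: tx cube_real_prod)
      ultimately have "has_mps (\<lambda>(t, x). u t x) ((0, x) + (t, 0)) (\<sigma>/2) (\<Sum>\<^sub>\<infinity>n. majorant N n / (s0 / 2) ^ n * \<sigma> ^ n)"
        using \<sigma> by (intro has_mps_recenter) auto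
      then show "real_analytic_at (\<lambda>(t, x). u t x) z"
        using has_mps_imp_real_analytic_at by (simp add: tx)
    qed simp
    fix t x assume t: "t \<in> {-T..T}"
    then have "\<bar>t\<bar> < \<sigma>" using T by auto
    then obtain D where D: "((\<lambda>t. u t x) has_vector_derivative D) (at t)"
      "((\<lambda>n. t ^ n *\<^sub>R residual (time_coeff u0) n x) has_sum D + cross3 (curl (u t) x) (u t x)) UNIV"
      unfolding u_def using has_sum_residual[OF ts _ open_cube_center[OF \<sigma>(1)]] by blast
    have "D + cross3 (curl (u t) x) (u t x) = 0"
      using has_sum_unique[OF D(2)] by (simp add: residual_time_coeff)
    moreover have "vector_derivative (\<lambda>s. u s x) (at t within {-T..T}) = D"
      using t T by (intro vector_derivative_at_within_ivl[OF D(1)]) auto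
    ultimately show "vector_derivative (\<lambda>s. u s x) (at t within {-T..T}) + cross3 (curl (u t) x) (u t x) = 0"
      by simp
  next
    fix x
    have "((\<lambda>n. 0 ^ n *\<^sub>R time_coeff u0 n x) has_sum u0 x) UNIV"
      by (rule has_sum_finite_neutralI[of "{0}"]) auto
    then show "u 0 x = u0 x"
      unfolding u_eq by (rule infsumI)
  qed
  then show ?thesis
    using T(1) analytic_solution_unique[OF T(1)] by blast
qed

end
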